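(* Let $\boldsymbol\Xi_T\in L^2(\Omega)^d$, $\beta\ge0$ and $$\mathcal J_\beta(\mathbf f)=\tfrac12\|\mathbf u(\cdot,T;\mathbf f)-\boldsymbol\Xi_T\|^2+\tfrac\beta2\|\mathbf f\|^2,\qquad\mathbf f\in L^2(\Omega)^d.$$ Let $r_0,r_1\colon\Omega\to\mathbb R$ be continuous with $0<\underline r_0\le r_0\le\overline r_0$ and $0<\underline r_1\le r_1\le\overline r_1$ for constants $\underline r_0,\overline r_0,\underline r_1,\overline r_1$, and let $\mathcal H=H^1(\Omega)^d$ be equipped with the inner product $$\langle\mathbf u,\mathbf v\rangle_{H^1(\Omega,r_0,r_1)}=(r_0\mathbf u,\mathbf v)+(r_1\nabla\mathbf u,\nabla\mathbf v),\qquad\mathbf u,\mathbf v\in H^1(\Omega)^d.$$ Let $\mathbf f\in L^2(\Omega)^d$ be fixed and let $\nabla\mathcal J_\beta=\nabla\mathcal J_\beta[\mathbf f]\in L^2(\Omega)^d$ be the $L^2$-gradient, i.e. the element with $\mathcal J'_\beta(\mathbf f;\delta_{\mathbf f})=(\nabla\mathcal J_\beta[\mathbf f],\delta_{\mathbf f})$ for all $\delta_{\mathbf f}\in L^2(\Omega)^d$, given by $$\nabla\mathcal J_\beta[\mathbf f]=-\frac1\rho\int_0^Tg(t)\mathbf u^\ast(\cdot,t;\mathbf f)\,dt+\beta\mathbf f.$$ Then the Sobolev gradient $\nabla_S\mathcal J_\beta=\nabla_S\mathcal J_\beta[\mathbf f]\in H^1(\Omega)^d$, i.e. the unique element satisfying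 $$\mathcal J_\beta'(\mathbf f;\delta_{\mathbf f})=\langle\nabla_S\mathcal J_\beta[\mathbf f],\delta_{\mathbf f}\rangle_{H^1(\Omega,r_0,r_1)}\qquad\forall\,\delta_{\mathbf f}\in H^1(\Omega)^d,$$ is the weak solution $\mathcal K$ of the elliptic boundary value problem $$-\nabla\cdot(r_1\nabla\mathcal K)+r_0\mathcal K=\nabla\mathcal J_\beta\ \text{ in }\Omega,\qquad\nabla\mathcal K\,\mathbf n=\mathbf 0\ \text{ on }\Gamma,$$ where $\mathbf n$ is the outward unit vector on the boundary $\Gamma$.
   Context: Setting. $\Omega\subset\mathbb R^d$ ($d\in\mathbb N$) is open and bounded with Lipschitz boundary $\Gamma$; $T>0$; $Q_T=\Omega\times(0,T]$, $\Sigma_T=\Gamma\times(0,T]$. $\rho,C_s,\kappa,T_0,\lambda,\mu,\alpha_T$ are positive constants and $\gamma=\alpha_T(3\lambda+2\mu)>0$. $\epsilon(\mathbf u)=\frac12(\nabla\mathbf u+(\nabla\mathbf u)^\top)$, $\sigma(\mathbf u)=2\mu\,\epsilon(\mathbf u)+\lambda\,\mathrm{Tr}(\epsilon(\mathbf u))\,\mathrm{Id}$. The kernel $k\in C^2([0,T])$ is strongly positive definite (in the standard sense for convolution kernels) and satisfies $\lim_{t\to\infty}k(t)=0$, $(-1)^jk^{(j)}(t)\ge 0$ for $j=0,1,2$ and $t\in[0,T]$, $k'\not\equiv0$. $(k\ast z)(\mathbf x,t)=\int_0^tk(t-s)z(\mathbf x,s)\,ds$ and $K^\ast(z)(s)=\int_s^Tk(t-s)z(t)\,dt$,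 $s\in[0,T]$. $(\cdot,\cdot)$ and $\|\cdot\|$ denote the inner product and norm of $L^2(\Omega)$, $L^2(\Omega)^d$ and $L^2(\Omega)^{d\times d}$. Function $g$: $g\in C^1([0,T])$ with $\partial_t(g(t)^2)>0$ for all $t\in[0,T]$. Problem $(P_1)$ with source $\mathbf f\in L^2(\Omega)^d$: $\rho\,\partial_{tt}\mathbf u-\nabla\cdot\sigma(\mathbf u)+\gamma\nabla\theta=g(t)\mathbf f(\mathbf x)$ in $Q_T$; $\rho C_s\partial_t\theta-\kappa\Delta\theta-k\ast\Delta\theta+T_0\gamma\nabla\cdot\partial_t\mathbf u=0$ in $Q_T$; $\mathbf u=\mathbf 0$, $\theta=0$ on $\Sigma_T$; $\mathbf u(\cdot,0)=\mathbf 0$, $\partial_t\mathbf u(\cdot,0)=\mathbf 0$, $\theta(\cdot,0)=0$ in $\Omega$. Solutions are weak: $(\mathbf u(t),\theta(t))\in H_0^1(\Omega)^d\times H_0^1(\Omega)$, and for a.e. $t$ and all $\boldsymbol\varphi\in H^1_0(\Omega)^d$, $\psi\in H^1_0(\Omega)$: $\rho(\partial_{tt}\mathbf u,\boldsymbol\varphi)+\mu(\nabla\mathbf u,\nabla\boldsymbol\varphi)+(\lambda+\mu)(\nabla\cdot\mathbf u,\nabla\cdot\boldsymbol\varphi)+\gamma(\nabla\theta,\boldsymbol\varphi)=(g(t)\mathbf f,\boldsymbol\varphi)$ and $\rho C_s(\partial_t\theta,\psi)+\kappa(\nabla\theta,\nabla\psi)+(k\ast\nabla\theta,\nabla\psi)-T_0\gamma(\partial_t\mathbf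 u,\nabla\psi)=0$. There is a unique weak solution $(\mathbf u(\cdot,\cdot;\mathbf f),\theta(\cdot,\cdot;\mathbf f))$ (known), with $\mathbf u\in C([0,T],H_0^1(\Omega)^d)$, $\partial_t\mathbf u\in C([0,T],L^2(\Omega)^d)\cap L^2((0,T),H_0^1(\Omega)^d)$, $\partial_{tt}\mathbf u\in L^2((0,T),L^2(\Omega)^d)$, $\theta\in C([0,T],H_0^1(\Omega))$, $\partial_t\theta\in L^2((0,T),H^1_0(\Omega))$. Adjoint problem: $(\mathbf u^\ast(\cdot;\mathbf f),\theta^\ast(\cdot;\mathbf f))$ is the (weak) solution of the terminal-value problem $\rho\,\partial_{tt}\mathbf u^\ast-\nabla\cdot\sigma(\mathbf u^\ast)+\gamma T_0\nabla\partial_t\theta^\ast=\mathbf 0$ in $Q_T$; $-\rho C_s\partial_t\theta^\ast-\kappa\Delta\theta^\ast-K^\ast(\Delta\theta^\ast)-\gamma\nabla\cdot\mathbf u^\ast=0$ in $Q_T$; $\mathbf u^\ast=\mathbf 0$, $\theta^\ast=0$ on $\Sigma_T$; $\mathbf u^\ast(\cdot,T)=\mathbf 0$, $\partial_t\mathbf u^\ast(\cdot,T)=\mathbf u(\cdot,T;\mathbf f)-\boldsymbol\Xi_T$, $\theta^\ast(\cdot,T)=0$ in $\Omega$. The Gâteaux derivative is $\mathcal J'_\beta(\mathbf f;\delta_{\mathbf f})=\lim_{\varepsilon\to0}\varepsilon^{-1}(\mathcal J_\beta(\mathbf f+\varepsilon\delta_{\mathbf f})-\mathcal J_\beta(\mathbf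 f))$, a bounded linear functional of $\delta_{\mathbf f}$. A weak solution of the elliptic problem is $\mathcal K\in H^1(\Omega)^d$ with $(r_1\nabla\mathcal K,\nabla\boldsymbol\varphi)+(r_0\mathcal K,\boldsymbol\varphi)=(\nabla\mathcal J_\beta,\boldsymbol\varphi)$ for all $\boldsymbol\varphi\in H^1(\Omega)^d$. *)

theory Defs
  imports "HOL-Analysis.Analysis"
begin

text \<open>
  Elements of Lebesgue and Sobolev spaces are represented by functions; two functions denote the
  same element iff they agree almost everywhere on the domain. Scalar fields have type
  \<open>real^'d \<Rightarrow> real\<close>, vector fields \<open>real^'d \<Rightarrow> real^'d\<close>. A time dependent field is a function of time
  with values in fields.
\<close>

subsection \<open>Lipschitz boundary\<close>

text \<open>Near every boundary point the set is, in a rotated frame whose last axis is \<open>e\<close>, the part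
  strictly above the graph of a Lipschitz function on the hyperplane orthogonal to \<open>e\<close>.\<close>

definition lipschitz_boundary :: "'a::euclidean_space set \<Rightarrow> bool" where
  "lipschitz_boundary \<Omega> \<longleftrightarrow>
     (\<forall>p\<in>frontier \<Omega>. \<exists>r>0. \<exists>e. norm e = 1 \<and>
        (\<exists>\<zeta>::'a \<Rightarrow> real. \<exists>L. L-lipschitz_on {y. y \<bullet> e = 0} \<zeta> \<and>
           \<Omega> \<inter> ball p r = {x \<in> ball p r. x \<bullet> e > \<zeta> (x - (x \<bullet> e) *\<^sub>R e)}))"


subsection \<open>Test functions\<close>

primrec Ck :: "nat \<Rightarrow> ('a::euclidean_space \<Rightarrow> real) \<Rightarrow> bool" where
  "Ck 0 \<phi> \<longleftrightarrow> continuous_on UNIV \<phi>"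
| "Ck (Suc n) \<phi> \<longleftrightarrow>
     (\<forall>x. \<phi> differentiable (at x)) \<and> (\<forall>v. Ck n (\<lambda>x. frechet_derivative \<phi> (at x) v))"

definition test_fun :: "'a::euclidean_space set \<Rightarrow> ('a \<Rightarrow> real) set" where
  "test_fun \<Omega> = {\<phi>. (\<forall>n. Ck n \<phi>) \<and> (\<exists>C. compact C \<and> C \<subseteq> \<Omega> \<and> (\<forall>x. x \<notin> C \<longrightarrow> \<phi> x = 0))}"


subsection \<open>Square integrable fields\<close>

definition L2 :: "'a::euclidean_space set \<Rightarrow> ('a \<Rightarrow> 'b::euclidean_space) set" where
  "L2 \<Omega> = {f. f \<in> borel_measurable (lebesgue_on \<Omega>) \<and> integrable (lebesgue_on \<Omega>) (\<lambda>x. (norm (f x))\<^sup>2)}"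

text \<open>For matrix valued fields \<open>\<bullet>\<close> is the Frobenius product.\<close>

definition inner_L2 ::
  "'a::euclidean_space set \<Rightarrow> ('a \<Rightarrow> 'b::euclidean_space) \<Rightarrow> ('a \<Rightarrow> 'b) \<Rightarrow> real" where
  "inner_L2 \<Omega> f h = (LINT x|lebesgue_on \<Omega>. f x \<bullet> h x)"

definition norm_L2 :: "'a::euclidean_space set \<Rightarrow> ('a \<Rightarrow> 'b::euclidean_space) \<Rightarrow> real" where
  "norm_L2 \<Omega> f = sqrt (inner_L2 \<Omega> f f)"

definition ae_eq :: "'a::euclidean_space set \<Rightarrow> ('a \<Rightarrow> 'b) \<Rightarrow> ('a \<Rightarrow> 'b) \<Rightarrow> bool" where
  "ae_eq \<Omega> f h \<longleftrightarrow> (AE x in lebesgue_on \<Omega>. f x = h x)"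

text \<open>The \<open>L2\<close>-valued integral of \<open>z\<close> over the time set \<open>I\<close>, characterised by duality. Working with
  the element of \<open>L2\<close>, rather than integrating \<open>\<lambda>s. z s x\<close> for each \<open>x\<close>, makes the
  integral independent of the representatives chosen for the \<open>z s\<close>.\<close>

definition has_L2_int ::
  "'a::euclidean_space set \<Rightarrow> real set \<Rightarrow> (real \<Rightarrow> 'a \<Rightarrow> 'b::euclidean_space) \<Rightarrow> ('a \<Rightarrow> 'b) \<Rightarrow> bool" where
  "has_L2_int \<Omega> I z w \<longleftrightarrow> w \<in> L2 \<Omega> \<and>
     (\<forall>\<phi>\<in>L2 \<Omega>. integrable (lebesgue_on I) (\<lambda>s. inner_L2 \<Omega> (z s) \<phi>) \<and>
        inner_L2 \<Omega> w \<phi> = (LINT s|lebesgue_on I. inner_L2 \<Omega> (z s) \<phi>))"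

definition L2_int ::
  "'a::euclidean_space set \<Rightarrow> real set \<Rightarrow> (real \<Rightarrow> 'a \<Rightarrow> 'b::euclidean_space) \<Rightarrow> 'a \<Rightarrow> 'b" where
  "L2_int \<Omega> I z = (SOME w. has_L2_int \<Omega> I z w)"


subsection \<open>Sobolev spaces\<close>

definition has_weak_grad ::
  "(real^'d) set \<Rightarrow> (real^'d \<Rightarrow> real) \<Rightarrow> (real^'d \<Rightarrow> real^'d) \<Rightarrow> bool" where
  "has_weak_grad \<Omega> f G \<longleftrightarrow> G \<in> L2 \<Omega> \<and>
     (\<forall>\<phi>\<in>test_fun \<Omega>. \<forall>j. inner_L2 \<Omega> f (\<lambda>x. frechet_derivative \<phi> (at x) (axis j 1))
        = - inner_L2 \<Omega> (\<lambda>x. G x $ j) \<phi>)"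

definition H1 :: "(real^'d) set \<Rightarrow> (real^'d \<Rightarrow> real) set" where
  "H1 \<Omega> = {f. f \<in> L2 \<Omega> \<and> (\<exists>G. has_weak_grad \<Omega> f G)}"

text \<open>Weak gradients are unique up to null sets only, hence the choice.\<close>

definition wgrad :: "(real^'d) set \<Rightarrow> (real^'d \<Rightarrow> real) \<Rightarrow> real^'d \<Rightarrow> real^'d" where
  "wgrad \<Omega> f = (SOME G. has_weak_grad \<Omega> f G)"

definition norm_H1 :: "(real^'d) set \<Rightarrow> (real^'d \<Rightarrow> real) \<Rightarrow> real" where
  "norm_H1 \<Omega> f = sqrt ((norm_L2 \<Omega> f)\<^sup>2 + (norm_L2 \<Omega> (wgrad \<Omega> f))\<^sup>2)"

definition H10 :: "(real^'d) set \<Rightarrow> (real^'d \<Rightarrow> real) set" where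
  "H10 \<Omega> = {f \<in> H1 \<Omega>. \<exists>\<phi>. (\<forall>n. \<phi> n \<in> test_fun \<Omega>) \<and>
     (\<lambda>n::nat. norm_H1 \<Omega> (\<lambda>x. \<phi> n x - f x)) \<longlonglongrightarrow> 0}"

definition H1v :: "(real^'d) set \<Rightarrow> (real^'d \<Rightarrow> real^'d) set" where
  "H1v \<Omega> = {u. \<forall>i. (\<lambda>x. u x $ i) \<in> H1 \<Omega>}"

definition H10v :: "(real^'d) set \<Rightarrow> (real^'d \<Rightarrow> real^'d) set" where
  "H10v \<Omega> = {u. \<forall>i. (\<lambda>x. u x $ i) \<in> H10 \<Omega>}"

text \<open>Row \<open>i\<close> of the Jacobian is the gradient of the \<open>i\<close>-th component.\<close>

definition wGrad :: "(real^'d) set \<Rightarrow> (real^'d \<Rightarrow> real^'d) \<Rightarrow> real^'d \<Rightarrow> real^'d^'d" where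
  "wGrad \<Omega> u x = (\<chi> i. wgrad \<Omega> (\<lambda>y. u y $ i) x)"

definition wdiv :: "(real^'d) set \<Rightarrow> (real^'d \<Rightarrow> real^'d) \<Rightarrow> real^'d \<Rightarrow> real" where
  "wdiv \<Omega> u x = (\<Sum>i\<in>UNIV. wGrad \<Omega> u x $ i $ i)"

definition norm_H1v :: "(real^'d) set \<Rightarrow> (real^'d \<Rightarrow> real^'d) \<Rightarrow> real" where
  "norm_H1v \<Omega> u = sqrt ((norm_L2 \<Omega> u)\<^sup>2 + (norm_L2 \<Omega> (wGrad \<Omega> u))\<^sup>2)"

text \<open>The dual of \<open>H10v\<close>. Only the values of a functional on \<open>H10v\<close> are relevant.\<close>

definition Hm1v :: "(real^'d) set \<Rightarrow> ((real^'d \<Rightarrow> real^'d) \<Rightarrow> real) set" where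
  "Hm1v \<Omega> = {F.
     (\<forall>\<phi>\<in>H10v \<Omega>. \<forall>\<psi>\<in>H10v \<Omega>. \<forall>a b. F (\<lambda>x. a *\<^sub>R \<phi> x + b *\<^sub>R \<psi> x) = a * F \<phi> + b * F \<psi>) \<and>
     (\<exists>C. \<forall>\<phi>\<in>H10v \<Omega>. \<bar>F \<phi>\<bar> \<le> C * norm_H1v \<Omega> \<phi>)}"

definition norm_Hm1v :: "(real^'d) set \<Rightarrow> ((real^'d \<Rightarrow> real^'d) \<Rightarrow> real) \<Rightarrow> real" where
  "norm_Hm1v \<Omega> F = (SUP \<phi>\<in>{\<phi>\<in>H10v \<Omega>. norm_H1v \<Omega> \<phi> \<le> 1}. \<bar>F \<phi>\<bar>)"


subsection \<open>Functions of time with values in a (semi)normed space of fields\<close>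

text \<open>\<open>C([0,T],X)\<close>, and \<open>L2((0,T),X)\<close> in the sense of Bochner; \<open>nrm\<close> is the norm of \<open>X\<close>.\<close>

definition C_into :: "real \<Rightarrow> 'x::minus set \<Rightarrow> ('x \<Rightarrow> real) \<Rightarrow> (real \<Rightarrow> 'x) set" where
  "C_into T X nrm = {v. (\<forall>t\<in>{0..T}. v t \<in> X) \<and>
     (\<forall>t\<in>{0..T}. ((\<lambda>s. nrm (v s - v t)) \<longlongrightarrow> 0) (at t within {0..T}))}"

definition simple_into :: "real \<Rightarrow> 'x set \<Rightarrow> (real \<Rightarrow> 'x) set" where
  "simple_into T X = {s. finite (s ` {0..T}) \<and> s ` {0..T} \<subseteq> X \<and>
     (\<forall>y. {t\<in>{0..T}. s t = y} \<in> sets lebesgue)}"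

definition L2_into :: "real \<Rightarrow> 'x::minus set \<Rightarrow> ('x \<Rightarrow> real) \<Rightarrow> (real \<Rightarrow> 'x) set" where
  "L2_into T X nrm = {v.
     (AE t in lebesgue_on {0..T}. v t \<in> X) \<and>
     (\<exists>s. (\<forall>n::nat. s n \<in> simple_into T X) \<and>
        (AE t in lebesgue_on {0..T}. (\<lambda>n. nrm (s n t - v t)) \<longlonglongrightarrow> 0)) \<and>
     integrable (lebesgue_on {0..T}) (\<lambda>t. (nrm (v t))\<^sup>2)}"

text \<open>Weak (distributional) derivative in time: of scalar functions, and of field valued functions.\<close>

definition weak_deriv :: "real \<Rightarrow> (real \<Rightarrow> real) \<Rightarrow> (real \<Rightarrow> real) \<Rightarrow> bool" where
  "weak_deriv T a b \<longleftrightarrow> (\<forall>\<eta>\<in>test_fun {0<..<T}.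
     (LINT t|lebesgue_on {0..T}. deriv \<eta> t * a t) = - (LINT t|lebesgue_on {0..T}. \<eta> t * b t))"

definition weak_time_deriv ::
  "'a::euclidean_space set \<Rightarrow> real \<Rightarrow> (real \<Rightarrow> 'a \<Rightarrow> 'b::euclidean_space) \<Rightarrow> (real \<Rightarrow> 'a \<Rightarrow> 'b) \<Rightarrow> bool" where
  "weak_time_deriv \<Omega> T v v' \<longleftrightarrow>
     (\<forall>\<phi>\<in>L2 \<Omega>. weak_deriv T (\<lambda>t. inner_L2 \<Omega> (v t) \<phi>) (\<lambda>t. inner_L2 \<Omega> (v' t) \<phi>))"


subsection \<open>Data of the problem\<close>

text \<open>Strong positivity on \<open>[0,T]\<close> in the sense of Nohel and Shea: \<open>k(t) - c exp(-t)\<close> is a kernel of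
  positive type for some \<open>c > 0\<close>.\<close>

definition strongly_positive_definite :: "real \<Rightarrow> (real \<Rightarrow> real) \<Rightarrow> bool" where
  "strongly_positive_definite T k \<longleftrightarrow> (\<exists>c>0. \<forall>\<tau>\<in>{0..T}. \<forall>y. continuous_on {0..\<tau>} y \<longrightarrow>
     0 \<le> integral {0..\<tau>} (\<lambda>t. y t * integral {0..t} (\<lambda>s. (k (t - s) - c * exp (- (t - s))) * y s)))"

definition admissible_kernel :: "real \<Rightarrow> (real \<Rightarrow> real) \<Rightarrow> bool" where
  "admissible_kernel T k \<longleftrightarrow>
     strongly_positive_definite T k \<and> (k \<longlongrightarrow> 0) at_top \<and>
     (\<exists>k' k''.
        (\<forall>t\<in>{0..T}. (k has_real_derivative k' t) (at t within {0..T})) \<and>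
        (\<forall>t\<in>{0..T}. (k' has_real_derivative k'' t) (at t within {0..T})) \<and>
        continuous_on {0..T} k'' \<and>
        (\<forall>t\<in>{0..T}. 0 \<le> k t \<and> k' t \<le> 0 \<and> 0 \<le> k'' t) \<and>
        (\<exists>t\<in>{0..T}. k' t \<noteq> 0))"

definition admissible_g :: "real \<Rightarrow> (real \<Rightarrow> real) \<Rightarrow> bool" where
  "admissible_g T g \<longleftrightarrow>
     (\<exists>g'. continuous_on {0..T} g' \<and>
        (\<forall>t\<in>{0..T}. (g has_real_derivative g' t) (at t within {0..T}))) \<and>
     (\<forall>t\<in>{0..T}. \<exists>D>0. ((\<lambda>s. (g s)\<^sup>2) has_real_derivative D) (at t within {0..T}))"


subsection \<open>Convolution operators\<close>

text \<open>\<open>(k * z)(t)\<close> is the integral of \<open>k(t-s) z(s)\<close> over \<open>0 < s < t\<close>, and \<open>K\<^sup>*(z)(s)\<close> is the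
  integral of \<open>k(t-s) z(t)\<close> over \<open>s < t < T\<close>.\<close>

definition conv ::
  "'a::euclidean_space set \<Rightarrow> (real \<Rightarrow> real) \<Rightarrow> (real \<Rightarrow> 'a \<Rightarrow> 'b::euclidean_space) \<Rightarrow> real \<Rightarrow> 'a \<Rightarrow> 'b" where
  "conv \<Omega> k z t = L2_int \<Omega> {0..t} (\<lambda>s x. k (t - s) *\<^sub>R z s x)"

definition adj_conv ::
  "'a::euclidean_space set \<Rightarrow> real \<Rightarrow> (real \<Rightarrow> real) \<Rightarrow> (real \<Rightarrow> 'a \<Rightarrow> 'b::euclidean_space) \<Rightarrow> real \<Rightarrow> 'a \<Rightarrow> 'b" where
  "adj_conv \<Omega> T k z s = L2_int \<Omega> {s..T} (\<lambda>t x. k (t - s) *\<^sub>R z t x)"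


subsection \<open>Weak solutions\<close>

definition weak_solution_P1 ::
  "(real^'d) set \<Rightarrow> real \<Rightarrow> real \<Rightarrow> real \<Rightarrow> real \<Rightarrow> real \<Rightarrow> real \<Rightarrow> real \<Rightarrow> real \<Rightarrow>
   (real \<Rightarrow> real) \<Rightarrow> (real \<Rightarrow> real) \<Rightarrow> (real^'d \<Rightarrow> real^'d) \<Rightarrow>
   (real \<Rightarrow> real^'d \<Rightarrow> real^'d) \<Rightarrow> (real \<Rightarrow> real^'d \<Rightarrow> real) \<Rightarrow> bool" where
  "weak_solution_P1 \<Omega> T \<rho> C\<^sub>s \<kappa> T\<^sub>0 lam \<mu> \<gamma> k g f u \<theta> \<longleftrightarrow>
     (\<exists>u' u'' \<theta>'.
        u \<in> C_into T (H10v \<Omega>) (norm_H1v \<Omega>) \<and>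
        u' \<in> C_into T (L2 \<Omega>) (norm_L2 \<Omega>) \<and> u' \<in> L2_into T (H10v \<Omega>) (norm_H1v \<Omega>) \<and>
        u'' \<in> L2_into T (L2 \<Omega>) (norm_L2 \<Omega>) \<and>
        \<theta> \<in> C_into T (H10 \<Omega>) (norm_H1 \<Omega>) \<and>
        \<theta>' \<in> L2_into T (H10 \<Omega>) (norm_H1 \<Omega>) \<and>
        weak_time_deriv \<Omega> T u u' \<and> weak_time_deriv \<Omega> T u' u'' \<and> weak_time_deriv \<Omega> T \<theta> \<theta>' \<and>
        (AE t in lebesgue_on {0..T}.
           (\<forall>\<phi>\<in>H10v \<Omega>.
              \<rho> * inner_L2 \<Omega> (u'' t) \<phi> + \<mu> * inner_L2 \<Omega> (wGrad \<Omega> (u t)) (wGrad \<Omega> \<phi>)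
              + (lam + \<mu>) * inner_L2 \<Omega> (wdiv \<Omega> (u t)) (wdiv \<Omega> \<phi>)
              + \<gamma> * inner_L2 \<Omega> (wgrad \<Omega> (\<theta> t)) \<phi>
              = inner_L2 \<Omega> (\<lambda>x. g t *\<^sub>R f x) \<phi>) \<and>
           (\<forall>\<psi>\<in>H10 \<Omega>.
              \<rho> * C\<^sub>s * inner_L2 \<Omega> (\<theta>' t) \<psi> + \<kappa> * inner_L2 \<Omega> (wgrad \<Omega> (\<theta> t)) (wgrad \<Omega> \<psi>)
              + inner_L2 \<Omega> (conv \<Omega> k (\<lambda>s. wgrad \<Omega> (\<theta> s)) t) (wgrad \<Omega> \<psi>)
              - T\<^sub>0 * \<gamma> * inner_L2 \<Omega> (u' t) (wgrad \<Omega> \<psi>) = 0)) \<and>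
        ae_eq \<Omega> (u 0) (\<lambda>x. 0) \<and> ae_eq \<Omega> (u' 0) (\<lambda>x. 0) \<and> ae_eq \<Omega> (\<theta> 0) (\<lambda>x. 0))"

text \<open>Weak solution of the adjoint terminal value problem with terminal velocity \<open>v\<^sub>T\<close>. As \<open>v\<^sub>T\<close> is
  merely in \<open>L2\<close>, the second time derivative takes values in the dual of \<open>H10v\<close>, so that
  \<open>u'' t \<phi>\<close> is a duality pairing. The terms \<open>-K\<^sup>*(\<Delta>\<theta>)\<close> and \<open>-\<gamma> div u\<close> are integrated by parts in
  space as in the direct problem.\<close>

definition weak_solution_adjoint ::
  "(real^'d) set \<Rightarrow> real \<Rightarrow> real \<Rightarrow> real \<Rightarrow> real \<Rightarrow> real \<Rightarrow> real \<Rightarrow> real \<Rightarrow> real \<Rightarrow>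
   (real \<Rightarrow> real) \<Rightarrow> (real^'d \<Rightarrow> real^'d) \<Rightarrow>
   (real \<Rightarrow> real^'d \<Rightarrow> real^'d) \<Rightarrow> (real \<Rightarrow> real^'d \<Rightarrow> real) \<Rightarrow> bool" where
  "weak_solution_adjoint \<Omega> T \<rho> C\<^sub>s \<kappa> T\<^sub>0 lam \<mu> \<gamma> k v\<^sub>T u \<theta> \<longleftrightarrow>
     (\<exists>u' u'' \<theta>'.
        u \<in> C_into T (H10v \<Omega>) (norm_H1v \<Omega>) \<and>
        u' \<in> C_into T (L2 \<Omega>) (norm_L2 \<Omega>) \<and>
        u'' \<in> L2_into T (Hm1v \<Omega>) (norm_Hm1v \<Omega>) \<and>
        \<theta> \<in> C_into T (H10 \<Omega>) (norm_H1 \<Omega>) \<and>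
        \<theta>' \<in> L2_into T (H10 \<Omega>) (norm_H1 \<Omega>) \<and>
        weak_time_deriv \<Omega> T u u' \<and>
        (\<forall>\<phi>\<in>H10v \<Omega>. weak_deriv T (\<lambda>t. inner_L2 \<Omega> (u' t) \<phi>) (\<lambda>t. u'' t \<phi>)) \<and>
        weak_time_deriv \<Omega> T \<theta> \<theta>' \<and>
        (AE t in lebesgue_on {0..T}.
           (\<forall>\<phi>\<in>H10v \<Omega>.
              \<rho> * u'' t \<phi> + \<mu> * inner_L2 \<Omega> (wGrad \<Omega> (u t)) (wGrad \<Omega> \<phi>)
              + (lam + \<mu>) * inner_L2 \<Omega> (wdiv \<Omega> (u t)) (wdiv \<Omega> \<phi>)
              + \<gamma> * T\<^sub>0 * inner_L2 \<Omega> (wgrad \<Omega> (\<theta>' t)) \<phi> = 0) \<and>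
           (\<forall>\<psi>\<in>H10 \<Omega>.
              - \<rho> * C\<^sub>s * inner_L2 \<Omega> (\<theta>' t) \<psi> + \<kappa> * inner_L2 \<Omega> (wgrad \<Omega> (\<theta> t)) (wgrad \<Omega> \<psi>)
              + inner_L2 \<Omega> (adj_conv \<Omega> T k (\<lambda>s. wgrad \<Omega> (\<theta> s)) t) (wgrad \<Omega> \<psi>)
              + \<gamma> * inner_L2 \<Omega> (u t) (wgrad \<Omega> \<psi>) = 0)) \<and>
        ae_eq \<Omega> (u T) (\<lambda>x. 0) \<and> ae_eq \<Omega> (u' T) v\<^sub>T \<and> ae_eq \<Omega> (\<theta> T) (\<lambda>x. 0))"

text \<open>Weak form of \<open>- div (r\<^sub>1 \<nabla>K) + r\<^sub>0 K = h\<close> in \<open>\<Omega>\<close> with \<open>\<nabla>K n = 0\<close> on the boundary; the Neumann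
  condition is natural, i.e. encoded by testing with all of \<open>H1v\<close>.\<close>

definition weak_solution_elliptic ::
  "(real^'d) set \<Rightarrow> (real^'d \<Rightarrow> real) \<Rightarrow> (real^'d \<Rightarrow> real) \<Rightarrow> (real^'d \<Rightarrow> real^'d) \<Rightarrow>
   (real^'d \<Rightarrow> real^'d) \<Rightarrow> bool" where
  "weak_solution_elliptic \<Omega> r\<^sub>0 r\<^sub>1 h K \<longleftrightarrow> K \<in> H1v \<Omega> \<and>
     (\<forall>\<phi>\<in>H1v \<Omega>. inner_L2 \<Omega> (\<lambda>x. r\<^sub>1 x *\<^sub>R wGrad \<Omega> K x) (wGrad \<Omega> \<phi>)
        + inner_L2 \<Omega> (\<lambda>x. r\<^sub>0 x *\<^sub>R K x) \<phi> = inner_L2 \<Omega> h \<phi>)"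


subsection \<open>Cost functional and gradients\<close>

text \<open>Here \<open>u f\<close> is the displacement belonging to the source \<open>f\<close>.\<close>

definition cost ::
  "'a::euclidean_space set \<Rightarrow> real \<Rightarrow> real \<Rightarrow> ('a \<Rightarrow> 'b::euclidean_space) \<Rightarrow>
   (('a \<Rightarrow> 'b) \<Rightarrow> real \<Rightarrow> 'a \<Rightarrow> 'b) \<Rightarrow> ('a \<Rightarrow> 'b) \<Rightarrow> real" where
  "cost \<Omega> T \<beta> \<Xi> u f = 1/2 * (norm_L2 \<Omega> (\<lambda>x. u f T x - \<Xi> x))\<^sup>2 + \<beta>/2 * (norm_L2 \<Omega> f)\<^sup>2"

definition has_gateaux_derivative ::
  "(('a \<Rightarrow> 'b::real_vector) \<Rightarrow> real) \<Rightarrow> ('a \<Rightarrow> 'b) \<Rightarrow> ('a \<Rightarrow> 'b) \<Rightarrow> real \<Rightarrow> bool" where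
  "has_gateaux_derivative J f \<delta> D \<longleftrightarrow>
     ((\<lambda>\<epsilon>. (J (\<lambda>x. f x + \<epsilon> *\<^sub>R \<delta> x) - J f) / \<epsilon>) \<longlongrightarrow> D) (at 0)"

definition is_L2_gradient ::
  "'a::euclidean_space set \<Rightarrow> (('a \<Rightarrow> 'b::euclidean_space) \<Rightarrow> real) \<Rightarrow> ('a \<Rightarrow> 'b) \<Rightarrow> ('a \<Rightarrow> 'b) \<Rightarrow> bool" where
  "is_L2_gradient \<Omega> J f G \<longleftrightarrow> G \<in> L2 \<Omega> \<and>
     (\<forall>\<delta>\<in>L2 \<Omega>. has_gateaux_derivative J f \<delta> (inner_L2 \<Omega> G \<delta>))"

definition inner_H1v ::
  "(real^'d) set \<Rightarrow> (real^'d \<Rightarrow> real) \<Rightarrow> (real^'d \<Rightarrow> real) \<Rightarrow>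
   (real^'d \<Rightarrow> real^'d) \<Rightarrow> (real^'d \<Rightarrow> real^'d) \<Rightarrow> real" where
  "inner_H1v \<Omega> r\<^sub>0 r\<^sub>1 u v =
     inner_L2 \<Omega> (\<lambda>x. r\<^sub>0 x *\<^sub>R u x) v + inner_L2 \<Omega> (\<lambda>x. r\<^sub>1 x *\<^sub>R wGrad \<Omega> u x) (wGrad \<Omega> v)"

definition is_sobolev_gradient ::
  "(real^'d) set \<Rightarrow> (real^'d \<Rightarrow> real) \<Rightarrow> (real^'d \<Rightarrow> real) \<Rightarrow>
   ((real^'d \<Rightarrow> real^'d) \<Rightarrow> real) \<Rightarrow> (real^'d \<Rightarrow> real^'d) \<Rightarrow> (real^'d \<Rightarrow> real^'d) \<Rightarrow> bool" where
  "is_sobolev_gradient \<Omega> r\<^sub>0 r\<^sub>1 J f S \<longleftrightarrow> S \<in> H1v \<Omega> \<and>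
     (\<forall>\<delta>\<in>H1v \<Omega>. has_gateaux_derivative J f \<delta> (inner_H1v \<Omega> r\<^sub>0 r\<^sub>1 S \<delta>))"

end

theory Submission
  imports Defs
begin

text \<open>
  On \<open>H1v\<close>, which is contained in \<open>L2\<close>, the Gateaux derivative is represented by the \<open>L2\<close>-gradient
  \<open>G\<close>, and limits are unique; so the defining equation of the Sobolev gradient and the weak form of
  the elliptic problem with right-hand side \<open>G\<close> are the same equation. Its solution exists because
  the fields \<open>(sqrt r\<^sub>0 v, sqrt r\<^sub>1 \<nabla>v)\<close> form the orthogonal complement in \<open>L2\<close> of a set built from
  test functions: projecting \<open>(G / sqrt r\<^sub>0, 0)\<close> onto it yields \<open>K\<close> together with a weak gradient of
  \<open>K\<close>. By the fundamental lemma of the calculus of variations this weak gradient agrees almost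
  everywhere with the one selected by \<open>wGrad\<close>.
\<close>

subsection \<open>Smooth functions\<close>

text \<open>Two features shape the argument. Fields are plain functions, so the inner products
  separate them only up to null sets. Moreover \<open>wgrad\<close> picks some weak gradient for
  each function, so it need not be linear, and linear combinations of pairs of a field with its
  selected gradient are awkward to handle. The projection is therefore carried out on pairs whose
  second component is any weak gradient: being annihilated by a family of fields is visibly stable
  under linear combinations and under limits, so that completeness of \<open>L2\<close> is the only
  analytic input. The square roots distribute each weight evenly over the two arguments of the inner
  product, which turns the weighted product into the plain one on pairs; the constant bounds on the
  weights make multiplication by the roots and by their reciprocals harmless.\<close>

lemma Ck_SucI:
  assumes "\<And>x. (\<phi> has_derivative D x) (at x)" and "\<And>v. Ck n (\<lambda>x. D x v)"
  shows "Ck (Suc n) \<phi>"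
  using assms by (auto simp: differentiable_def frechet_derivative_at[OF assms(1), symmetric])

lemma Ck_SucD:
  assumes "Ck (Suc n) \<phi>"
  shows "(\<phi> has_derivative frechet_derivative \<phi> (at x)) (at x)"
    and "Ck n (\<lambda>x. frechet_derivative \<phi> (at x) v)"
  using assms by (auto simp: frechet_derivative_works)

text \<open>The product rule leaves one factor undifferentiated, so \<open>Ck_mult\<close> has to
  lower the order of that factor by one.\<close>

lemma Ck_Suc_imp_Ck: "Ck (Suc n) \<phi> \<Longrightarrow> Ck n \<phi>"
proof (induction n arbitrary: \<phi>)
  case 0
  then show ?case
    by (auto intro!: continuous_at_imp_continuous_on differentiable_imp_continuous_within)
next
  case (Suc n)
  show ?case
    by (rule Ck_SucI[OF Ck_SucD(1)[OF Suc.prems]]) (rule Suc.IH[OF Ck_SucD(2)[OF Suc.prems]])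
qed

lemma Ck_const: "Ck n (\<lambda>x. c)"
proof (induction n arbitrary: c)
  case (Suc n)
  show ?case
    using Suc[of 0] by (intro Ck_SucI[where D = "\<lambda>x v. 0"] has_derivative_const)
qed auto

lemma Ck_add: "Ck n \<phi> \<Longrightarrow> Ck n \<psi> \<Longrightarrow> Ck n (\<lambda>x. \<phi> x + \<psi> x)"
proof (induction n arbitrary: \<phi> \<psi>)
  case (Suc n)
  show ?case
    by (rule Ck_SucI, rule has_derivative_add[OF Ck_SucD(1) Ck_SucD(1)])
      (use Suc.prems in \<open>auto intro!: Suc.IH Ck_SucD(2)\<close>)
qed (auto intro: continuous_intros)

lemma Ck_mult: "Ck n \<phi> \<Longrightarrow> Ck n \<psi> \<Longrightarrow> Ck n (\<lambda>x. \<phi> x * \<psi> x)"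
proof (induction n arbitrary: \<phi> \<psi>)
  case (Suc n)
  show ?case
    by (rule Ck_SucI, rule has_derivative_mult[OF Ck_SucD(1)[OF Suc.prems(1)] Ck_SucD(1)[OF Suc.prems(2)]])
      (intro Ck_add Suc.IH Ck_SucD(2)[OF Suc.prems(1)] Ck_SucD(2)[OF Suc.prems(2)]
        Suc.prems[THEN Ck_Suc_imp_Ck] Suc.prems)+
qed (auto intro: continuous_intros)

lemma Ck_prod: "finite I \<Longrightarrow> (\<And>i. i \<in> I \<Longrightarrow> Ck n (\<phi> i)) \<Longrightarrow> Ck n (\<lambda>x. \<Prod>i\<in>I. \<phi> i x)"
  by (induction I rule: finite_induct) (auto intro: Ck_const Ck_mult)

text \<open>Including the powers \<open>1 / t\<close> makes this family closed under differentiation up to linear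
  combinations, so that no polynomials in \<open>1 / t\<close> need to be tracked.\<close>

definition flat :: "nat \<Rightarrow> real \<Rightarrow> real" where
  "flat k t = (if t > 0 then (1 / t) ^ k * exp (- (1 / t)) else 0)"

text \<open>Seen through \<open>inverse t\<close>, the limit from the right says that the
  exponential outgrows every power; from the left the function is constantly 0.\<close>

lemma flat_tendsto_0: "(flat k \<longlongrightarrow> 0) (at 0)"
proof -
  have "((\<lambda>t. (inverse t) ^ k / exp (inverse t)) \<longlongrightarrow> (0::real)) (at_right 0)"
    by (rule filterlim_compose[OF tendsto_power_div_exp_0 filterlim_inverse_at_top_right])
  then have "(flat k \<longlongrightarrow> 0) (at_right 0)"
    by (rule Lim_transform_eventually)
      (auto simp: flat_def eventually_at_filter exp_minus field_simps)
  moreover have "(flat k \<longlongrightarrow> 0) (at_left 0)"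
    by (rule Lim_transform_eventually[OF tendsto_const])
      (auto simp: flat_def eventually_at_filter)
  ultimately show ?thesis
    by (simp add: filterlim_at_split)
qed

lemma DERIV_flat: "(flat k has_real_derivative flat (k + 2) t - k * flat (k + 1) t) (at t)"
proof -
  consider "t > 0" | "t < 0" | "t = 0" by linarith
  then show ?thesis
  proof cases
    case 1
    have "((\<lambda>t. (1 / t) ^ k * exp (- (1 / t))) has_real_derivative
        flat (k + 2) t - k * flat (k + 1) t) (at t)"
      using 1
      apply (auto intro!: derivative_eq_intros simp: flat_def power2_eq_square)
      \<comment> \<open>The power rule produces the exponent \<open>k - 1\<close> in the natural
        numbers, so \<open>k = 0\<close> has to be treated separately.\<close>
      apply (cases k; simp add: field_simps power2_eq_square)
      done
    then show ?thesis
      by (rule has_field_derivative_transform_within_open[where S = "{0<..}"])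
        (use 1 in \<open>auto simp: flat_def\<close>)
  next
    case 2
    have "((\<lambda>t. 0) has_real_derivative flat (k + 2) t - k * flat (k + 1) t) (at t)"
      using 2 by (auto simp: flat_def)
    then show ?thesis
      by (rule has_field_derivative_transform_within_open[where S = "{..<0}"])
        (use 2 in \<open>auto simp: flat_def\<close>)
  next
    case 3
    \<comment> \<open>The difference quotient at 0 is again a member of the family, so its limit is
      already known.\<close>
    have "(\<lambda>h. (flat k (0 + h) - flat k 0) / h) = flat (Suc k)"
      by (auto simp: flat_def)
    then show ?thesis
      using flat_tendsto_0[of "Suc k"] 3 by (simp add: DERIV_def) (simp add: flat_def)
  qed
qed

text \<open>The inner function is affine, so the chain rule contributes only the constant
  \<open>v \<bullet> w\<close>, and a derivative is a combination of members with larger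
  \<open>k\<close> and the same inner function. Hence the induction on \<open>n\<close> runs over
  all \<open>k\<close> at once.\<close>

lemma Ck_flat_affine: "Ck n (\<lambda>x. flat k (x \<bullet> w + d))"
proof (induction n arbitrary: k)
  case 0
  have "continuous_on UNIV (flat k)"
    using DERIV_flat by (blast intro: continuous_at_imp_continuous_on DERIV_isCont)
  then have "continuous_on UNIV (\<lambda>x. flat k (x \<bullet> w + d))"
    by (rule continuous_on_compose2) (auto intro!: continuous_intros)
  then show ?case by simp
next
  case (Suc n)
  have "((\<lambda>x. flat k (x \<bullet> w + d)) has_derivative
      (\<lambda>v. (v \<bullet> w) * (flat (k + 2) (x \<bullet> w + d) + (- k) * flat (k + 1) (x \<bullet> w + d)))) (at x)" for x
  proof -
    have "((\<lambda>x. x \<bullet> w + d) has_derivative (\<lambda>v. v \<bullet> w)) (at x)"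
      by (auto intro!: derivative_eq_intros)
    from has_derivative_compose[OF this DERIV_flat[unfolded has_field_derivative_def]] show ?thesis
      by (simp add: algebra_simps)
  qed
  then show ?case
    by (rule Ck_SucI) (intro Ck_mult Ck_add Ck_const Suc)
qed

text \<open>Every face of the box contributes one factor, which vanishes on and beyond that face.
  The scaling factor \<open>Suc m\<close>, which is never 0, steepens the flanks as \<open>m\<close>
  grows, so that the indicator of the open box is reached in the limit.\<close>

definition bump :: "nat \<Rightarrow> 'a::euclidean_space \<Rightarrow> 'a \<Rightarrow> 'a \<Rightarrow> real" where
  "bump m a b x = (\<Prod>i\<in>Basis. flat 0 (Suc m * ((x - a) \<bullet> i)) * flat 0 (Suc m * ((b - x) \<bullet> i)))"

lemma flat_0_bounds: "0 \<le> flat 0 t" "flat 0 t \<le> 1"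
  by (auto simp: flat_def)

lemma bump_bounds: "0 \<le> bump m a b x" "bump m a b x \<le> 1"
  by (auto simp: bump_def flat_0_bounds intro!: prod_nonneg prod_le_1 mult_le_one)

lemma Ck_bump: "Ck n (bump m a b)"
proof -
  have "bump m a b = (\<lambda>x. \<Prod>i\<in>Basis. flat 0 (x \<bullet> (real (Suc m) *\<^sub>R i) + - real (Suc m) * (a \<bullet> i))
      * flat 0 (x \<bullet> (- real (Suc m) *\<^sub>R i) + real (Suc m) * (b \<bullet> i)))"
    unfolding bump_def
    by (intro ext prod.cong refl arg_cong2[where f = times] arg_cong[where f = "flat 0"])
      (auto simp: inner_diff_left algebra_simps)
  then show ?thesis
    by (simp only:) (rule Ck_prod[OF finite_Basis], rule Ck_mult; rule Ck_flat_affine)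
qed

lemma bump_eq_0: "x \<notin> box a b \<Longrightarrow> bump m a b x = 0"
  unfolding bump_def mem_box
  by (auto simp: prod_zero_iff flat_def inner_diff_left zero_less_mult_iff)

text \<open>The closed box is the compact set outside of which the function vanishes; this is why
  the closed box is placed inside \<Omega>.\<close>

lemma bump_in_test_fun:
  assumes "cbox a b \<subseteq> \<Omega>"
  shows "bump m a b \<in> test_fun \<Omega>"
proof -
  have "bump m a b x = 0" if "x \<notin> cbox a b" for x
    using that bump_eq_0 box_subset_cbox by blast
  then show ?thesis
    using assms Ck_bump by (auto simp: test_fun_def intro!: exI[of _ "cbox a b"])
qed

lemma flat_scaled_tendsto_1:
  fixes s :: real
  assumes "s > 0"
  shows "(\<lambda>m. flat 0 (Suc m * s)) \<longlonglongrightarrow> 1"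
proof -
  have "(\<lambda>m. exp (- ((1 / s) * inverse (real (Suc m))))) \<longlonglongrightarrow> exp (- ((1 / s) * 0))"
    by (intro tendsto_intros LIMSEQ_inverse_real_of_nat)
  moreover have "exp (- ((1 / s) * inverse (real (Suc m)))) = flat 0 (Suc m * s)" for m
    using assms by (auto simp: flat_def zero_less_mult_iff field_simps simp del: of_nat_Suc)
  ultimately show ?thesis by simp
qed

lemma bump_tendsto_indicator: "(\<lambda>m. bump m a b x) \<longlonglongrightarrow> indicator (box a b) x"
proof (cases "x \<in> box a b")
  case True
  have "(\<lambda>m. bump m a b x) \<longlonglongrightarrow> (\<Prod>i\<in>(Basis::'a set). 1 * 1)"
    unfolding bump_def
    by (intro tendsto_prod tendsto_mult flat_scaled_tendsto_1)
      (use True in \<open>auto simp: mem_box inner_diff_left simp del: of_nat_Suc\<close>)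
  then show ?thesis using True by simp
qed (simp add: bump_eq_0)

subsection \<open>The fundamental lemma of the calculus of variations\<close>

text \<open>Dominated convergence along the functions \<open>bump m a b\<close>: their values lie
  between 0 and 1, so \<open>\<bar>g x\<bar>\<close> is a majorant.\<close>

lemma set_integral_box_eq_0:
  fixes g :: "'a::euclidean_space \<Rightarrow> real"
  assumes \<Omega>: "open \<Omega>" and g: "integrable (lebesgue_on \<Omega>) g"
    and test: "\<And>\<phi>. \<phi> \<in> test_fun \<Omega> \<Longrightarrow> (LINT x|lebesgue_on \<Omega>. g x * \<phi> x) = 0"
    and box: "cbox a b \<subseteq> \<Omega>"
  shows "(LINT x:box a b|lebesgue_on \<Omega>. g x) = 0"
proof -
  have meas: "bump m a b \<in> borel_measurable (lebesgue_on \<Omega>)" for m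
    using Ck_bump[of 0 m a b]
    by (intro continuous_imp_measurable_on_sets_lebesgue)
      (auto intro: continuous_on_subset simp: \<Omega> lebesgue_openin)
  have ind: "(indicator (box a b) :: 'a \<Rightarrow> real) \<in> borel_measurable (lebesgue_on \<Omega>)"
    using box box_subset_cbox[of a b]
    by (intro borel_measurable_indicator) (auto simp: sets_restrict_space_iff \<Omega>)
  have "(\<lambda>m. LINT x|lebesgue_on \<Omega>. g x * bump m a b x) \<longlonglongrightarrow>
      (LINT x|lebesgue_on \<Omega>. g x * indicator (box a b) x)"
  proof (rule integral_dominated_convergence[where w = "\<lambda>x. \<bar>g x\<bar>"])
    show "AE x in lebesgue_on \<Omega>. norm (g x * bump m a b x) \<le> \<bar>g x\<bar>" for m
      using bump_bounds[of m a b] by (auto simp: abs_mult intro!: mult_left_le)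
  qed (use g meas ind in \<open>auto intro!: tendsto_intros bump_tendsto_indicator\<close>)
  then have "(LINT x|lebesgue_on \<Omega>. g x * indicator (box a b) x) = 0"
    using test[OF bump_in_test_fun[OF box]] by (simp add: LIMSEQ_const_iff)
  then show ?thesis
    by (simp add: set_lebesgue_integral_def mult.commute)
qed

lemma Int_stable_boxes: "Int_stable (range (\<lambda>(a, b). box a b :: 'a::euclidean_space set))"
  by (auto simp: Int_stable_def box_Int_box)

text \<open>Dynkin's argument, with the open boxes as intersection-stable generator. Intersecting
  with a fixed box keeps every set inside \<Omega> and gives the complement step a total integral
  that is known to be 0.\<close>

lemma set_integral_borel_Int_box_eq_0:
  fixes g :: "'a::euclidean_space \<Rightarrow> real"
  assumes \<Omega>: "open \<Omega>" and g: "integrable (lebesgue_on \<Omega>) g"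
    and boxes: "\<And>a b. cbox a b \<subseteq> \<Omega> \<Longrightarrow> (LINT x:box a b|lebesgue_on \<Omega>. g x) = 0"
    and cd: "cbox c d \<subseteq> \<Omega>" and B: "B \<in> sets borel"
  shows "(LINT x:B \<inter> box c d|lebesgue_on \<Omega>. g x) = 0"
proof -
  let ?G = "range (\<lambda>(a, b). box a b :: 'a set)"
  have borel: "sets borel = sigma_sets UNIV ?G"
    by (subst borel_eq_box) simp
  have cd': "box c d \<subseteq> \<Omega>"
    using cd box_subset_cbox by blast
  have sets: "A \<inter> box c d \<in> sets (lebesgue_on \<Omega>)" if "A \<in> sets borel" for A
    using that cd' by (auto simp: sets_restrict_space_iff \<Omega>)
  have int: "set_integrable (lebesgue_on \<Omega>) (A \<inter> box c d) g" if "A \<in> sets borel" for A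
    using sets[OF that] g unfolding set_integrable_def by (rule integrable_mult_indicator)
  have "B \<in> sigma_sets UNIV ?G"
    using B borel by simp
  then show ?thesis
  proof (induction B rule: sigma_sets_induct_disjoint[OF Int_stable_boxes, of UNIV, simplified, consumes 1, case_names basic empty compl union])
    case (basic A)
    then obtain a b where A: "A = box a b" by auto
    show ?case
    proof (cases "A \<inter> box c d = {}")
      case False
      obtain a' b' where ab: "A \<inter> box c d = box a' b'"
        unfolding A box_Int_box by blast
      \<comment> \<open>\<open>boxes\<close> asks for the closed box to lie in \<Omega>. An empty
        open box can have a nonempty degenerate closed box, so the identity with the closure relies
        on the intersection being nonempty.\<close>
      have "cbox a' b' = closure (box a' b')"
        using False ab by (simp add: closure_box)
      also have "\<dots> \<subseteq> cbox c d"
        unfolding ab[symmetric] using box_subset_cbox by (intro closure_minimal) auto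
      finally show ?thesis
        using cd boxes[of a' b'] ab by auto
    qed (simp add: set_lebesgue_integral_def)
  next
    case (compl A)
    then have A: "A \<in> sets borel" using borel by simp
    have "(LINT x:box c d|lebesgue_on \<Omega>. g x) =
        (LINT x:A \<inter> box c d|lebesgue_on \<Omega>. g x) + (LINT x:(UNIV - A) \<inter> box c d|lebesgue_on \<Omega>. g x)"
    proof (subst set_integral_Un[symmetric])
      have "A \<inter> box c d \<union> (UNIV - A) \<inter> box c d = box c d" by blast
      then show "(LINT x:box c d|lebesgue_on \<Omega>. g x) =
          (LINT x:A \<inter> box c d \<union> (UNIV - A) \<inter> box c d|lebesgue_on \<Omega>. g x)" by simp
    qed (use A int in auto)
    then show ?case
      using boxes[OF cd] compl by simp
  next
    case (union A)
    then have A: "A i \<in> sets borel" for i using borel by auto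
    have "(LINT x:(\<Union>i. A i \<inter> box c d)|lebesgue_on \<Omega>. g x) =
        (\<Sum>i. LINT x:A i \<inter> box c d|lebesgue_on \<Omega>. g x)"
    proof (rule lebesgue_integral_countable_add)
      show "A i \<inter> box c d \<inter> (A j \<inter> box c d) = {}" if "i \<noteq> j" for i j
        using union(1) that by (auto simp: disjoint_family_on_def)
      show "set_integrable (lebesgue_on \<Omega>) (\<Union>i. A i \<inter> box c d) g"
        using int[of "\<Union>i. A i"] A by auto
    qed (use sets A in auto)
    then show ?case
      using union(3) by simp
  qed (auto simp: set_lebesgue_integral_def)
qed

text \<open>After restriction to \<Omega> this supplies the setting of \<open>density_zero\<close>.
  A countable Borel cover serves because completion does not change the measure of Borel
  sets.\<close>

lemma sigma_finite_lebesgue: "sigma_finite_measure (lebesgue :: 'a::euclidean_space measure)"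
proof
  obtain \<C> :: "'a set set" where "countable \<C>" "\<C> \<subseteq> sets lborel" "\<Union>\<C> = UNIV"
      "\<forall>C\<in>\<C>. emeasure lborel C \<noteq> \<infinity>"
    using lborel.sigma_finite_countable by auto
  then show "\<exists>\<C>::'a set set. countable \<C> \<and> \<C> \<subseteq> sets lebesgue \<and> \<Union>\<C> = space lebesgue \<and>
      (\<forall>C\<in>\<C>. emeasure lebesgue C \<noteq> \<infinity>)"
    by (intro exI[of _ \<C>]) (auto simp: subset_iff)
qed

text \<open>On a box with closure in \<Omega>, the integrals of \<open>g\<close> over all measurable
  subsets vanish, which forces \<open>g\<close> to vanish almost everywhere there. It remains to
  glue boxes together.\<close>

lemma fundamental_lemma_calculus_of_variations:
  fixes g :: "'a::euclidean_space \<Rightarrow> real"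
  assumes \<Omega>: "open \<Omega>" and g: "integrable (lebesgue_on \<Omega>) g"
    and test: "\<And>\<phi>. \<phi> \<in> test_fun \<Omega> \<Longrightarrow> (LINT x|lebesgue_on \<Omega>. g x * \<phi> x) = 0"
  shows "AE x in lebesgue_on \<Omega>. g x = 0"
proof -
  interpret sigma_finite_measure "lebesgue_on \<Omega>"
    using \<Omega> by (intro sigma_finite_measure_restrict_space sigma_finite_lebesgue) simp
  have on_box: "AE x in lebesgue_on \<Omega>. x \<in> box c d \<longrightarrow> g x = 0" if cd: "cbox c d \<subseteq> \<Omega>" for c d
  proof -
    have cd': "box c d \<in> sets (lebesgue_on \<Omega>)"
      using cd box_subset_cbox[of c d] by (auto simp: sets_restrict_space_iff \<Omega>)
    have "(LINT x:A|lebesgue_on \<Omega>. indicator (box c d) x *\<^sub>R g x) = 0"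
      if A: "A \<in> sets (lebesgue_on \<Omega>)" for A
    proof -
      \<comment> \<open>The Dynkin argument covers Borel sets only. A Lebesgue set is a Borel set up
        to part of a null set, which the integral ignores.\<close>
      have "A \<in> sets (completion lborel)"
        using A by (auto simp: sets_restrict_space_iff \<Omega>)
      then obtain S N N' where SN: "A = S \<union> N" "N \<subseteq> N'" "N' \<in> null_sets lborel" "S \<in> sets lborel"
        by (rule sets_completionE)
      have "AE x in lebesgue. x \<notin> N'"
        using SN(3) by (intro AE_not_in null_sets_completionI)
      then have "AE x in lebesgue_on \<Omega>. x \<notin> N'"
        by (auto simp: AE_restrict_space_iff \<Omega>)
      then have "AE x in lebesgue_on \<Omega>. indicator A x *\<^sub>R indicator (box c d) x *\<^sub>R g x
          = indicator (S \<inter> box c d) x *\<^sub>R g x"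
        by eventually_elim (use SN in \<open>auto simp: indicator_def\<close>)
      then have "(LINT x:A|lebesgue_on \<Omega>. indicator (box c d) x *\<^sub>R g x)
          = (LINT x:S \<inter> box c d|lebesgue_on \<Omega>. g x)"
        unfolding set_lebesgue_integral_def
      proof (rule integral_cong_AE[rotated 2])
        have meas [measurable]: "g \<in> borel_measurable (lebesgue_on \<Omega>)"
          using g by blast
        have "S \<inter> box c d \<in> sets (lebesgue_on \<Omega>)"
          using cd' SN(4) by (auto simp: sets_restrict_space_iff \<Omega>)
        note [measurable] = A cd' this
        show "(\<lambda>x. indicat_real A x *\<^sub>R indicat_real (box c d) x *\<^sub>R g x)
            \<in> borel_measurable (lebesgue_on \<Omega>)"
          by measurable
        show "(\<lambda>x. indicat_real (S \<inter> box c d) x *\<^sub>R g x) \<in> borel_measurable (lebesgue_on \<Omega>)"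
          by measurable
      qed
      also have "\<dots> = 0"
        using SN(4) cd set_integral_box_eq_0[OF \<Omega> g test]
        by (intro set_integral_borel_Int_box_eq_0[OF \<Omega> g]) auto
      finally show ?thesis .
    qed
    then have "AE x in lebesgue_on \<Omega>. indicator (box c d) x *\<^sub>R g x = 0"
      using cd' g by (intro density_zero integrable_mult_indicator)
    then show ?thesis
      by eventually_elim (auto simp: indicator_def split: if_splits)
  qed
  define F where "F = {box c d |c d. cbox c d \<subseteq> \<Omega>}"
  \<comment> \<open>Exceptional null sets may be united only over a countable family, so a countable
    subcover is extracted.\<close>
  obtain F' where F': "F' \<subseteq> F" "countable F'" "\<Union>F' = \<Union>F"
    using Lindelof[of F] by (auto simp: F_def)
  have "AE x in lebesgue_on \<Omega>. \<forall>Q\<in>F'. x \<in> Q \<longrightarrow> g x = 0"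
    using F'(1) on_box by (subst AE_ball_countable[OF F'(2)]) (auto simp: F_def)
  moreover have "AE x in lebesgue_on \<Omega>. x \<in> \<Omega>"
    by (rule AE_I2) simp
  ultimately show ?thesis
  proof eventually_elim
    case (elim x)
    obtain c d where "x \<in> box c d" "cbox c d \<subseteq> \<Omega>"
      using open_contains_cbox[OF \<Omega> elim(2)] by metis
    then have "x \<in> \<Union>F'"
      using F'(3) by (auto simp: F_def)
    with elim(1) show ?case by blast
  qed
qed

subsection \<open>The space of square integrable fields\<close>

lemma L2_D:
  assumes "f \<in> L2 \<Omega>"
  shows "f \<in> borel_measurable (lebesgue_on \<Omega>)"
    and "integrable (lebesgue_on \<Omega>) (\<lambda>x. (norm (f x))\<^sup>2)"
  using assms by (auto simp: L2_def)

lemma integrable_inner_L2: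
  assumes f: "f \<in> L2 \<Omega>" and h: "h \<in> L2 \<Omega>"
  shows "integrable (lebesgue_on \<Omega>) (\<lambda>x. f x \<bullet> h x)"
proof (rule Bochner_Integration.integrable_bound)
  show "integrable (lebesgue_on \<Omega>) (\<lambda>x. (norm (f x))\<^sup>2 + (norm (h x))\<^sup>2)"
    using L2_D(2)[OF f] L2_D(2)[OF h] by simp
  have "\<bar>f x \<bullet> h x\<bar> \<le> (norm (f x))\<^sup>2 + (norm (h x))\<^sup>2" for x
    using Cauchy_Schwarz_ineq2[of "f x" "h x"] sum_squares_bound[of "norm (f x)" "norm (h x)"]
      zero_le_power2[of "norm (f x)"] zero_le_power2[of "norm (h x)"]
    by linarith
  then show "AE x in lebesgue_on \<Omega>. norm (f x \<bullet> h x) \<le> norm ((norm (f x))\<^sup>2 + (norm (h x))\<^sup>2)"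
    by auto
qed (use L2_D(1)[OF f] L2_D(1)[OF h] in measurable)

lemma L2_scaleR: "f \<in> L2 \<Omega> \<Longrightarrow> (\<lambda>x. c *\<^sub>R f x) \<in> L2 \<Omega>"
  by (auto simp: L2_def power_mult_distrib)

lemma L2_add:
  assumes f: "f \<in> L2 \<Omega>" and h: "h \<in> L2 \<Omega>"
  shows "(\<lambda>x. f x + h x) \<in> L2 \<Omega>"
proof -
  have "(norm (f x + h x))\<^sup>2 = (norm (f x))\<^sup>2 + 2 * (f x \<bullet> h x) + (norm (h x))\<^sup>2" for x
    by (simp add: power2_norm_eq_inner inner_add_left inner_add_right inner_commute)
  then show ?thesis
    using L2_D[OF f] L2_D[OF h] integrable_inner_L2[OF f h] by (auto simp: L2_def)
qed

lemma L2_diff: "f \<in> L2 \<Omega> \<Longrightarrow> h \<in> L2 \<Omega> \<Longrightarrow> (\<lambda>x. f x - h x) \<in> L2 \<Omega>"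
  using L2_add[of f \<Omega> "\<lambda>x. (-1) *\<^sub>R h x"] L2_scaleR[of h \<Omega> "-1"] by simp

lemma L2_0: "(\<lambda>x. 0) \<in> L2 \<Omega>"
  by (auto simp: L2_def)

lemma L2_mult_bounded:
  assumes f: "f \<in> L2 \<Omega>" and c: "c \<in> borel_measurable (lebesgue_on \<Omega>)"
    and le: "\<And>x. x \<in> \<Omega> \<Longrightarrow> \<bar>c x\<bar> \<le> C"
  shows "(\<lambda>x. c x *\<^sub>R f x) \<in> L2 \<Omega>"
  unfolding L2_def
proof (intro CollectI conjI)
  show "integrable (lebesgue_on \<Omega>) (\<lambda>x. (norm (c x *\<^sub>R f x))\<^sup>2)"
  proof (rule Bochner_Integration.integrable_bound)
    show "integrable (lebesgue_on \<Omega>) (\<lambda>x. C\<^sup>2 * (norm (f x))\<^sup>2)"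
      using L2_D(2)[OF f] by simp
    have "(c x)\<^sup>2 * (norm (f x))\<^sup>2 \<le> C\<^sup>2 * (norm (f x))\<^sup>2" if "x \<in> \<Omega>" for x
      using le[OF that] by (intro mult_right_mono) (auto simp: abs_le_square_iff[symmetric])
    then show "AE x in lebesgue_on \<Omega>. norm ((norm (c x *\<^sub>R f x))\<^sup>2) \<le> norm (C\<^sup>2 * (norm (f x))\<^sup>2)"
      by (intro AE_I2) (auto simp: power_mult_distrib)
  qed (use L2_D(1)[OF f] c in measurable)
qed (use L2_D(1)[OF f] c in measurable)

lemma inner_L2_commute: "inner_L2 \<Omega> f h = inner_L2 \<Omega> h f"
  by (simp add: inner_L2_def inner_commute)

lemma inner_L2_add_left:
  "f \<in> L2 \<Omega> \<Longrightarrow> h \<in> L2 \<Omega> \<Longrightarrow> k \<in> L2 \<Omega> \<Longrightarrow>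
    inner_L2 \<Omega> (\<lambda>x. f x + h x) k = inner_L2 \<Omega> f k + inner_L2 \<Omega> h k"
  by (simp add: inner_L2_def inner_add_left integrable_inner_L2)

lemma inner_L2_diff_left:
  "f \<in> L2 \<Omega> \<Longrightarrow> h \<in> L2 \<Omega> \<Longrightarrow> k \<in> L2 \<Omega> \<Longrightarrow>
    inner_L2 \<Omega> (\<lambda>x. f x - h x) k = inner_L2 \<Omega> f k - inner_L2 \<Omega> h k"
  by (simp add: inner_L2_def inner_diff_left integrable_inner_L2)

lemma inner_L2_scaleR_left: "inner_L2 \<Omega> (\<lambda>x. c *\<^sub>R f x) k = c * inner_L2 \<Omega> f k"
  by (simp add: inner_L2_def)

lemma inner_L2_add_right:
  "f \<in> L2 \<Omega> \<Longrightarrow> h \<in> L2 \<Omega> \<Longrightarrow> k \<in> L2 \<Omega> \<Longrightarrow>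
    inner_L2 \<Omega> k (\<lambda>x. f x + h x) = inner_L2 \<Omega> k f + inner_L2 \<Omega> k h"
  by (simp add: inner_L2_commute[of _ k] inner_L2_add_left)

lemma inner_L2_diff_right:
  "f \<in> L2 \<Omega> \<Longrightarrow> h \<in> L2 \<Omega> \<Longrightarrow> k \<in> L2 \<Omega> \<Longrightarrow>
    inner_L2 \<Omega> k (\<lambda>x. f x - h x) = inner_L2 \<Omega> k f - inner_L2 \<Omega> k h"
  by (simp add: inner_L2_commute[of _ k] inner_L2_diff_left)

lemma inner_L2_scaleR_right: "inner_L2 \<Omega> k (\<lambda>x. c *\<^sub>R f x) = c * inner_L2 \<Omega> k f"
  by (simp add: inner_L2_def)

lemmas inner_L2_linear =
  inner_L2_add_left inner_L2_diff_left inner_L2_scaleR_left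
  inner_L2_add_right inner_L2_diff_right inner_L2_scaleR_right
  L2_add L2_diff L2_scaleR

lemma inner_L2_self_nonneg: "0 \<le> inner_L2 \<Omega> f f"
  by (simp add: inner_L2_def)

lemma inner_L2_self: "inner_L2 \<Omega> f f = (LINT x|lebesgue_on \<Omega>. (norm (f x))\<^sup>2)"
  by (simp add: inner_L2_def power2_norm_eq_inner)

text \<open>The value at the vertex \<open>b / c\<close> gives the bound. Besides the Cauchy-Schwarz
  inequality it serves the approximate minimisers in \<open>L2_projection\<close>.\<close>

lemma quadratic_nonneg_imp_discriminant:
  fixes a b c :: real
  assumes "\<And>t. 0 \<le> a - 2 * t * b + t\<^sup>2 * c" and "0 \<le> c"
  shows "b\<^sup>2 \<le> a * c"
proof (cases "c = 0")
  case True
  have "b = 0"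
  proof (rule ccontr)
    assume "b \<noteq> 0"
    \<comment> \<open>For \<open>c = 0\<close> this argument gives the expression the value
      -1.\<close>
    then show False
      using assms(1)[of "(a + 1) / (2 * b)"] True by simp
  qed
  then show ?thesis using True by simp
next
  case False
  then show ?thesis
    using assms(1)[of "b / c"] assms(2)
    by (simp add: field_simps power2_eq_square split: if_splits)
qed

lemma inner_L2_Cauchy_Schwarz:
  assumes "f \<in> L2 \<Omega>" "h \<in> L2 \<Omega>"
  shows "(inner_L2 \<Omega> f h)\<^sup>2 \<le> inner_L2 \<Omega> f f * inner_L2 \<Omega> h h"
proof (rule quadratic_nonneg_imp_discriminant[OF _ inner_L2_self_nonneg])
  fix t
  have "inner_L2 \<Omega> (\<lambda>x. f x - t *\<^sub>R h x) (\<lambda>x. f x - t *\<^sub>R h x)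
      = inner_L2 \<Omega> f f - 2 * t * inner_L2 \<Omega> f h + t\<^sup>2 * inner_L2 \<Omega> h h"
    using assms by (simp add: inner_L2_linear inner_L2_commute[of _ h f] power2_eq_square algebra_simps)
  then show "0 \<le> inner_L2 \<Omega> f f - 2 * t * inner_L2 \<Omega> f h + t\<^sup>2 * inner_L2 \<Omega> h h"
    using inner_L2_self_nonneg by metis
qed

lemma tendsto_inner_L2:
  assumes F: "\<And>n. F n \<in> L2 \<Omega>" and f: "f \<in> L2 \<Omega>" and k: "k \<in> L2 \<Omega>"
    and lim: "(\<lambda>n. inner_L2 \<Omega> (\<lambda>x. F n x - f x) (\<lambda>x. F n x - f x)) \<longlonglongrightarrow> 0"
  shows "(\<lambda>n. inner_L2 \<Omega> (F n) k) \<longlonglongrightarrow> inner_L2 \<Omega> f k"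
proof -
  have "(\<lambda>n. (inner_L2 \<Omega> (F n) k - inner_L2 \<Omega> f k)\<^sup>2) \<longlonglongrightarrow> 0"
  proof (rule tendsto_sandwich[OF _ _ tendsto_const])
    show "(\<lambda>n. inner_L2 \<Omega> (\<lambda>x. F n x - f x) (\<lambda>x. F n x - f x) * inner_L2 \<Omega> k k) \<longlonglongrightarrow> 0"
      using tendsto_mult_left_zero[OF lim] by simp
    show "\<forall>\<^sub>F n in sequentially. (inner_L2 \<Omega> (F n) k - inner_L2 \<Omega> f k)\<^sup>2
        \<le> inner_L2 \<Omega> (\<lambda>x. F n x - f x) (\<lambda>x. F n x - f x) * inner_L2 \<Omega> k k"
      using inner_L2_Cauchy_Schwarz[OF L2_diff[OF F f] k]
      by (simp add: inner_L2_diff_left F f k)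
  qed simp
  from tendsto_real_sqrt[OF this]
  have "(\<lambda>n. inner_L2 \<Omega> (F n) k - inner_L2 \<Omega> f k) \<longlonglongrightarrow> 0"
    by (simp add: tendsto_rabs_zero_iff)
  then show ?thesis
    by (simp add: LIM_zero_iff)
qed

subsection \<open>Completeness\<close>

text \<open>The weights \<open>4 ^ n\<close> balance two needs: against the bound
  \<open>(1/8) ^ n\<close> they leave a summable \<open>(1/2) ^ n\<close>, and being the squares of
  \<open>2 ^ n\<close> they force increments of size at most \<open>(1/2) ^ n\<close> eventually, at
  almost every point. The series of increments then telescopes.\<close>

lemma L2_fast_Cauchy_AE_convergent:
  fixes F :: "nat \<Rightarrow> 'a::euclidean_space \<Rightarrow> 'b::euclidean_space"
  assumes F: "\<And>n. F n \<in> L2 \<Omega>"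
    and fast: "\<And>n. inner_L2 \<Omega> (\<lambda>x. F (Suc n) x - F n x) (\<lambda>x. F (Suc n) x - F n x) \<le> (1/8) ^ n"
  shows "AE x in lebesgue_on \<Omega>. convergent (\<lambda>n. F n x)"
proof -
  let ?h = "\<lambda>n x. 4 ^ n * (norm (F (Suc n) x - F n x))\<^sup>2"
  note [measurable] = L2_D(1)[OF F]
  have int: "integrable (lebesgue_on \<Omega>) (?h n)" for n
    using L2_D(2)[OF L2_diff[OF F F]] by simp
  have "(\<integral>\<^sup>+x. (\<Sum>n. ennreal (?h n x)) \<partial>lebesgue_on \<Omega>)
      = (\<Sum>n. \<integral>\<^sup>+x. ennreal (?h n x) \<partial>lebesgue_on \<Omega>)"
    by (rule nn_integral_suminf) measurable
  also have "\<dots> \<le> (\<Sum>n. ennreal ((1/2) ^ n))"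
  proof (intro suminf_le summableI)
    fix n
    have "(\<integral>\<^sup>+x. ennreal (?h n x) \<partial>lebesgue_on \<Omega>) = ennreal (LINT x|lebesgue_on \<Omega>. ?h n x)"
      using int by (intro nn_integral_eq_integral) auto
    also have "(LINT x|lebesgue_on \<Omega>. ?h n x)
        = 4 ^ n * inner_L2 \<Omega> (\<lambda>x. F (Suc n) x - F n x) (\<lambda>x. F (Suc n) x - F n x)"
      by (simp add: inner_L2_self)
    also have "\<dots> \<le> 4 ^ n * (1/8) ^ n"
      using fast[of n] by simp
    also have "\<dots> = (1/2) ^ n"
      by (simp flip: power_mult_distrib)
    finally show "(\<integral>\<^sup>+x. ennreal (?h n x) \<partial>lebesgue_on \<Omega>) \<le> ennreal ((1/2) ^ n)"
      by (simp add: ennreal_leI)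
  qed
  also have "\<dots> < \<infinity>"
    by (subst suminf_ennreal2) (auto intro!: summable_geometric)
  finally have "AE x in lebesgue_on \<Omega>. (\<Sum>n. ennreal (?h n x)) \<noteq> \<infinity>"
    by (intro nn_integral_PInf_AE) auto
  then show ?thesis
  proof eventually_elim
    case (elim x)
    then have "summable (\<lambda>n. ?h n x)"
      by (intro summable_suminf_not_top) auto
    then have "(\<lambda>n. ?h n x) \<longlonglongrightarrow> 0"
      by (rule summable_LIMSEQ_zero)
    then have "\<forall>\<^sub>F n in sequentially. ?h n x < 1"
      by (rule order_tendstoD) simp
    then have "\<forall>\<^sub>F n in sequentially. norm (F (Suc n) x - F n x) \<le> (1/2) ^ n"
    proof eventually_elim
      case (elim n)
      have "(2 ^ n * norm (F (Suc n) x - F n x))\<^sup>2 \<le> 1\<^sup>2"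
        using elim power_mult[of "2::real" 2 n] power_mult[of "2::real" n 2]
        by (simp add: power_mult_distrib mult.commute)
      then have "2 ^ n * norm (F (Suc n) x - F n x) \<le> 1"
        by (rule power2_le_imp_le) simp
      then show ?case
        by (simp add: field_simps power_divide)
    qed
    then have "summable (\<lambda>n. F (Suc n) x - F n x)"
      by (rule summable_comparison_test_ev) (simp add: summable_geometric)
    then have "convergent (\<lambda>n. \<Sum>i<n. F (Suc i) x - F i x)"
      by (simp add: summable_iff_convergent)
    then have "convergent (\<lambda>n. (F n x - F 0 x) + F 0 x)"
      by (intro convergent_add convergent_const) (simp add: sum_lessThan_telescope[of "\<lambda>n. F n x"])
    then show ?case by simp
  qed
qed

text \<open>Fatou's lemma lets a bound on \<open>F m - F n\<close> pass to the pointwise limit.\<close>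

lemma L2_limit_bound:
  fixes F :: "nat \<Rightarrow> 'a::euclidean_space \<Rightarrow> 'b::euclidean_space"
  assumes F: "\<And>n. F n \<in> L2 \<Omega>" and h: "h \<in> L2 \<Omega>"
    and f: "f \<in> borel_measurable (lebesgue_on \<Omega>)"
    and lim: "AE x in lebesgue_on \<Omega>. (\<lambda>n. F n x) \<longlonglongrightarrow> f x"
    and bound: "\<forall>\<^sub>F n in sequentially. inner_L2 \<Omega> (\<lambda>x. F n x - h x) (\<lambda>x. F n x - h x) \<le> c"
    and c: "0 \<le> c"
  shows "f \<in> L2 \<Omega>" and "inner_L2 \<Omega> (\<lambda>x. f x - h x) (\<lambda>x. f x - h x) \<le> c"
proof -
  note [measurable] = L2_D(1)[OF F] L2_D(1)[OF h] f
  have "(\<integral>\<^sup>+x. ennreal ((norm (f x - h x))\<^sup>2) \<partial>lebesgue_on \<Omega>)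
      = (\<integral>\<^sup>+x. liminf (\<lambda>n. ennreal ((norm (F n x - h x))\<^sup>2)) \<partial>lebesgue_on \<Omega>)"
  proof (rule nn_integral_cong_AE)
    show "AE x in lebesgue_on \<Omega>. ennreal ((norm (f x - h x))\<^sup>2)
        = liminf (\<lambda>n. ennreal ((norm (F n x - h x))\<^sup>2))"
      using lim
    proof eventually_elim
      case (elim x)
      then have "(\<lambda>n. ennreal ((norm (F n x - h x))\<^sup>2)) \<longlonglongrightarrow> ennreal ((norm (f x - h x))\<^sup>2)"
        by (intro tendsto_intros)
      from lim_imp_Liminf[OF _ this] show ?case
        by simp
    qed
  qed
  also have "\<dots> \<le> liminf (\<lambda>n. \<integral>\<^sup>+x. ennreal ((norm (F n x - h x))\<^sup>2) \<partial>lebesgue_on \<Omega>)"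
    by (rule nn_integral_liminf) measurable
  also have "\<dots> \<le> liminf (\<lambda>n. ennreal c)"
  proof (rule Liminf_mono)
    show "\<forall>\<^sub>F n in sequentially. (\<integral>\<^sup>+x. ennreal ((norm (F n x - h x))\<^sup>2) \<partial>lebesgue_on \<Omega>) \<le> ennreal c"
      using bound
    proof eventually_elim
      case (elim n)
      then show ?case
        using L2_D(2)[OF L2_diff[OF F h]]
        by (subst nn_integral_eq_integral) (auto simp: inner_L2_self intro!: ennreal_leI)
    qed
  qed
  finally have le: "(\<integral>\<^sup>+x. ennreal ((norm (f x - h x))\<^sup>2) \<partial>lebesgue_on \<Omega>) \<le> ennreal c"
    by (simp add: Liminf_const)
  have int: "integrable (lebesgue_on \<Omega>) (\<lambda>x. (norm (f x - h x))\<^sup>2)"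
    using le by (intro integrableI_bounded) (auto simp: le_less_trans)
  then have "(\<lambda>x. f x - h x) \<in> L2 \<Omega>"
    by (simp add: L2_def)
  from L2_add[OF this h] show "f \<in> L2 \<Omega>" by simp
  show "inner_L2 \<Omega> (\<lambda>x. f x - h x) (\<lambda>x. f x - h x) \<le> c"
    using le c nn_integral_eq_integral[OF int] by (simp add: inner_L2_self)
qed

lemma L2_complete:
  fixes F :: "nat \<Rightarrow> 'a::euclidean_space \<Rightarrow> 'b::euclidean_space"
  assumes F: "\<And>n. F n \<in> L2 \<Omega>"
    and Cauchy: "\<And>e. e > 0 \<Longrightarrow>
      \<exists>N. \<forall>m\<ge>N. \<forall>n\<ge>N. inner_L2 \<Omega> (\<lambda>x. F m x - F n x) (\<lambda>x. F m x - F n x) \<le> e"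
  obtains f where "f \<in> L2 \<Omega>"
    and "(\<lambda>n. inner_L2 \<Omega> (\<lambda>x. F n x - f x) (\<lambda>x. F n x - f x)) \<longlonglongrightarrow> 0"
proof -
  have "\<forall>k. \<exists>N. \<forall>m\<ge>N. \<forall>n\<ge>N.
      inner_L2 \<Omega> (\<lambda>x. F m x - F n x) (\<lambda>x. F m x - F n x) \<le> (1/8) ^ k"
    by (intro allI Cauchy) simp
  then obtain N where N: "inner_L2 \<Omega> (\<lambda>x. F m x - F n x) (\<lambda>x. F m x - F n x) \<le> (1/8) ^ k"
    if "m \<ge> N k" "n \<ge> N k" for k m n
    by metis
  \<comment> \<open>The sum makes \<open>r\<close> monotone and at least \<open>N k\<close>; the
    added \<open>k\<close> makes it unbounded.\<close>
  define r where "r k = (\<Sum>i\<le>k. N i) + k" for k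
  have r: "N k \<le> r k" "r k \<le> r (Suc k)" "k \<le> r k" for k
    by (auto simp: r_def intro: trans_le_add1 member_le_sum)
  have "AE x in lebesgue_on \<Omega>. convergent (\<lambda>k. F (r k) x)"
  proof (rule L2_fast_Cauchy_AE_convergent)
    show "inner_L2 \<Omega> (\<lambda>x. F (r (Suc k)) x - F (r k) x) (\<lambda>x. F (r (Suc k)) x - F (r k) x) \<le> (1/8) ^ k" for k
      using r[of k] by (intro N) auto
  qed (rule F)
  define f where "f x = lim (\<lambda>k. F (r k) x)" for x
  have f: "f \<in> borel_measurable (lebesgue_on \<Omega>)"
    unfolding f_def using L2_D(1)[OF F] by (intro borel_measurable_lim_metric)
  have lim: "AE x in lebesgue_on \<Omega>. (\<lambda>k. F (r k) x) \<longlonglongrightarrow> f x"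
    using \<open>AE x in lebesgue_on \<Omega>. convergent (\<lambda>k. F (r k) x)\<close>
    by eventually_elim (simp add: f_def convergent_LIMSEQ_iff)
  have bound: "\<exists>n0. \<forall>n\<ge>n0. f \<in> L2 \<Omega> \<and> inner_L2 \<Omega> (\<lambda>x. f x - F n x) (\<lambda>x. f x - F n x) \<le> e"
    if "e > 0" for e
  proof -
    obtain n0 where n0: "inner_L2 \<Omega> (\<lambda>x. F m x - F n x) (\<lambda>x. F m x - F n x) \<le> e"
      if "m \<ge> n0" "n \<ge> n0" for m n
      using Cauchy[OF \<open>e > 0\<close>] by blast
    have "f \<in> L2 \<Omega> \<and> inner_L2 \<Omega> (\<lambda>x. f x - F n x) (\<lambda>x. f x - F n x) \<le> e" if "n \<ge> n0" for n
    proof -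
      \<comment> \<open>With \<open>n\<close> fixed, only the other index runs along the
        subsequence. The limit bound therefore holds for the whole sequence.\<close>
      have "\<forall>\<^sub>F k in sequentially. inner_L2 \<Omega> (\<lambda>x. F (r k) x - F n x) (\<lambda>x. F (r k) x - F n x) \<le> e"
        using eventually_ge_at_top[of n0]
        by eventually_elim (use r(3) that in \<open>auto intro: n0 order_trans\<close>)
      from L2_limit_bound[OF F F f lim this] \<open>e > 0\<close> show ?thesis by simp
    qed
    then show ?thesis by blast
  qed
  show thesis
  proof
    show "f \<in> L2 \<Omega>"
      using bound[of 1] by auto
    have "(\<lambda>n. inner_L2 \<Omega> (\<lambda>x. f x - F n x) (\<lambda>x. f x - F n x)) \<longlonglongrightarrow> 0"
    proof (rule LIMSEQ_I)
      fix e :: real assume "e > 0"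
      then obtain n0 where n0: "\<And>n. n \<ge> n0 \<Longrightarrow> inner_L2 \<Omega> (\<lambda>x. f x - F n x) (\<lambda>x. f x - F n x) \<le> e / 2"
        using bound[of "e / 2"] half_gt_zero by blast
      have "norm (inner_L2 \<Omega> (\<lambda>x. f x - F n x) (\<lambda>x. f x - F n x) - 0) < e" if "n \<ge> n0" for n
        using n0[OF that] \<open>e > 0\<close> by (simp add: inner_L2_self_nonneg)
      then show "\<exists>no. \<forall>n\<ge>no. norm (inner_L2 \<Omega> (\<lambda>x. f x - F n x) (\<lambda>x. f x - F n x) - 0) < e"
        by blast
    qed
    then show "(\<lambda>n. inner_L2 \<Omega> (\<lambda>x. F n x - f x) (\<lambda>x. F n x - f x)) \<longlonglongrightarrow> 0"
      by (simp add: inner_L2_self norm_minus_commute)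
  qed
qed

subsection \<open>Orthogonal projection\<close>

text \<open>Taking \<open>V\<close> as an annihilator spares a separate proof that it is closed: a
  minimising sequence has vanishing pairings with \<open>S\<close>, and pairings pass to the
  limit.\<close>

lemma L2_projection:
  fixes S :: "('a::euclidean_space \<Rightarrow> 'b::euclidean_space) set"
  assumes S: "S \<subseteq> L2 \<Omega>" and h: "h \<in> L2 \<Omega>"
  defines "V \<equiv> {w \<in> L2 \<Omega>. \<forall>z\<in>S. inner_L2 \<Omega> w z = 0}"
  obtains p where "p \<in> V" and "\<And>w. w \<in> V \<Longrightarrow> inner_L2 \<Omega> p w = inner_L2 \<Omega> h w"
proof -
  define q where "q w = inner_L2 \<Omega> (\<lambda>x. h x - w x) (\<lambda>x. h x - w x)" for w
  define d where "d = Inf (q ` V)"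
  have V_L2: "w \<in> L2 \<Omega>" if "w \<in> V" for w
    using that by (simp add: V_def)
  have V_add: "(\<lambda>x. v x + c *\<^sub>R w x) \<in> V" if "v \<in> V" "w \<in> V" for v w c
    using that S by (auto simp: V_def inner_L2_linear subset_iff)
  have q: "q w = inner_L2 \<Omega> h h - 2 * inner_L2 \<Omega> h w + inner_L2 \<Omega> w w" if "w \<in> L2 \<Omega>" for w
    using that h by (simp add: q_def inner_L2_linear inner_L2_commute[of _ w h])
  have "bdd_below (q ` V)"
    by (intro bdd_belowI[of _ 0]) (auto simp: q_def inner_L2_self_nonneg)
  then have d_le: "d \<le> q w" if "w \<in> V" for w
    unfolding d_def using that by (intro cINF_lower)
  have "(\<lambda>x. 0) \<in> V"
    by (simp add: V_def L2_0) (simp add: inner_L2_def)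
  then have "\<exists>w\<in>V. q w < d + 1 / Suc n" for n
    using cInf_lessD[of "q ` V" "d + 1 / Suc n"] by (auto simp: d_def)
  then obtain W where W: "\<And>n. W n \<in> V" "\<And>n. q (W n) < d + 1 / Suc n"
    by metis
  have near: "inner_L2 \<Omega> (\<lambda>x. W m x - W n x) (\<lambda>x. W m x - W n x) \<le> 2 / Suc m + 2 / Suc n" for m n
  proof -
    have [simp]: "W n \<in> L2 \<Omega>" for n
      using W V_L2 by blast
    have mid: "(\<lambda>x. (1/2) *\<^sub>R (W m x + 1 *\<^sub>R W n x)) \<in> V"
      using V_add[OF \<open>(\<lambda>x. 0) \<in> V\<close> V_add[OF W(1)[of m] W(1)[of n], of 1], of "1/2"] by simp
    \<comment> \<open>The parallelogram law: the midpoint stays in \<open>V\<close>, so its distance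
      value is at least \<open>d\<close>, and the slacks of \<open>W m\<close> and
      \<open>W n\<close> bound their mutual distance.\<close>
    have "inner_L2 \<Omega> (\<lambda>x. W m x - W n x) (\<lambda>x. W m x - W n x)
        = 2 * q (W m) + 2 * q (W n) - 4 * q (\<lambda>x. (1/2) *\<^sub>R (W m x + 1 *\<^sub>R W n x))"
      using h V_L2[OF mid]
      by (simp add: q inner_L2_linear inner_L2_commute[of _ "W n" "W m"] algebra_simps)
    also have "\<dots> \<le> 2 / Suc m + 2 / Suc n"
      using W(2)[of m] W(2)[of n] d_le[OF mid] by simp
    finally show ?thesis .
  qed
  have "\<exists>N. \<forall>m\<ge>N. \<forall>n\<ge>N. inner_L2 \<Omega> (\<lambda>x. W m x - W n x) (\<lambda>x. W m x - W n x) \<le> e"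
    if "e > 0" for e
  proof -
    obtain N where N: "inverse (real (Suc N)) < e / 4"
      using reals_Archimedean[of "e / 4"] \<open>e > 0\<close> by (metis divide_pos_pos zero_less_numeral)
    have small: "2 / real (Suc m) \<le> e / 2" if "m \<ge> N" for m
    proof -
      have "inverse (real (Suc m)) \<le> inverse (real (Suc N))"
        using that by (intro le_imp_inverse_le) auto
      moreover have "2 / real (Suc m) = 2 * inverse (real (Suc m))"
        by (rule divide_inverse)
      ultimately show ?thesis using N by linarith
    qed
    have "inner_L2 \<Omega> (\<lambda>x. W m x - W n x) (\<lambda>x. W m x - W n x) \<le> e" if "m \<ge> N" "n \<ge> N" for m n
    proof -
      have "2 / real (Suc m) \<le> e / 2" "2 / real (Suc n) \<le> e / 2"
        using that by (blast intro: small)+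
      then show ?thesis
        using near[of m n] by linarith
    qed
    then show ?thesis by blast
  qed
  then obtain p where p: "p \<in> L2 \<Omega>"
      "(\<lambda>n. inner_L2 \<Omega> (\<lambda>x. W n x - p x) (\<lambda>x. W n x - p x)) \<longlonglongrightarrow> 0"
    using L2_complete[of W \<Omega>, OF V_L2[OF W(1)]] by blast
  have lim: "(\<lambda>n. inner_L2 \<Omega> (W n) w) \<longlonglongrightarrow> inner_L2 \<Omega> p w" if "w \<in> L2 \<Omega>" for w
    by (rule tendsto_inner_L2[OF V_L2[OF W(1)] p(1) that p(2)])
  show thesis
  proof
    have "inner_L2 \<Omega> p z = 0" if "z \<in> S" for z
      using lim[of z] that S W(1) by (auto simp: V_def LIMSEQ_const_iff subset_iff)
    then show "p \<in> V"
      using p(1) by (simp add: V_def)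
    show "inner_L2 \<Omega> p w = inner_L2 \<Omega> h w" if w: "w \<in> V" for w
    proof -
      \<comment> \<open>\<open>W n\<close> minimises only up to \<open>1 / Suc n\<close>. Moving it
        along \<open>w\<close> gives a quadratic in \<open>t\<close> that is nonnegative after
        adding this slack, and its discriminant bounds the defect of orthogonality.\<close>
      have le: "(inner_L2 \<Omega> h w - inner_L2 \<Omega> (W n) w)\<^sup>2 \<le> inverse (Suc n) * inner_L2 \<Omega> w w" for n
      proof (rule quadratic_nonneg_imp_discriminant[OF _ inner_L2_self_nonneg])
        fix t
        have "d \<le> q (\<lambda>x. W n x + t *\<^sub>R w x)"
          by (intro d_le V_add W w)
        also have "\<dots> = q (W n) - 2 * t * (inner_L2 \<Omega> h w - inner_L2 \<Omega> (W n) w)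
            + t\<^sup>2 * inner_L2 \<Omega> w w"
          using V_L2[OF V_add[OF W(1) w]] V_L2[OF W(1)] V_L2[OF w] h
          by (simp add: q inner_L2_linear inner_L2_commute[of _ w "W n"] power2_eq_square algebra_simps)
        finally show "0 \<le> inverse (real (Suc n)) - 2 * t * (inner_L2 \<Omega> h w - inner_L2 \<Omega> (W n) w)
            + t\<^sup>2 * inner_L2 \<Omega> w w"
          using W(2)[of n] by (simp add: divide_inverse)
      qed
      have "(inner_L2 \<Omega> h w - inner_L2 \<Omega> p w)\<^sup>2 \<le> 0 * inner_L2 \<Omega> w w"
      proof (rule LIMSEQ_le)
        show "(\<lambda>n. (inner_L2 \<Omega> h w - inner_L2 \<Omega> (W n) w)\<^sup>2)
            \<longlonglongrightarrow> (inner_L2 \<Omega> h w - inner_L2 \<Omega> p w)\<^sup>2"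
          by (intro tendsto_intros lim V_L2[OF w])
        show "(\<lambda>n. inverse (real (Suc n)) * inner_L2 \<Omega> w w) \<longlonglongrightarrow> 0 * inner_L2 \<Omega> w w"
          by (intro tendsto_intros LIMSEQ_inverse_real_of_nat)
      qed (use le in blast)
      then show ?thesis by simp
    qed
  qed
qed

subsection \<open>Component fields\<close>

lemma L2_bounded_linear:
  fixes B :: "'b::euclidean_space \<Rightarrow> 'c::euclidean_space"
  assumes B: "bounded_linear B" and f: "f \<in> L2 \<Omega>"
  shows "(\<lambda>x. B (f x)) \<in> L2 \<Omega>"
proof -
  obtain C where C: "\<And>y. norm (B y) \<le> norm y * C"
    using bounded_linear.bounded[OF B] by blast
  have [measurable]: "B \<in> borel_measurable borel"
    using B by (intro borel_measurable_continuous_onI linear_continuous_on)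
  note [measurable] = L2_D(1)[OF f]
  have "integrable (lebesgue_on \<Omega>) (\<lambda>x. (norm (B (f x)))\<^sup>2)"
  proof (rule Bochner_Integration.integrable_bound)
    show "integrable (lebesgue_on \<Omega>) (\<lambda>x. C\<^sup>2 * (norm (f x))\<^sup>2)"
      using L2_D(2)[OF f] by simp
    have "(norm (B (f x)))\<^sup>2 \<le> C\<^sup>2 * (norm (f x))\<^sup>2" for x
      using power_mono[OF C[of "f x"], of 2] by (simp add: power_mult_distrib mult.commute)
    then show "AE x in lebesgue_on \<Omega>. norm ((norm (B (f x)))\<^sup>2) \<le> norm (C\<^sup>2 * (norm (f x))\<^sup>2)"
      by auto
  qed measurable
  then show ?thesis
    by (simp add: L2_def)
qed

lemma L2_fst: "f \<in> L2 \<Omega> \<Longrightarrow> (\<lambda>x. fst (f x)) \<in> L2 \<Omega>"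
  by (rule L2_bounded_linear[OF bounded_linear_fst])

lemma L2_snd: "f \<in> L2 \<Omega> \<Longrightarrow> (\<lambda>x. snd (f x)) \<in> L2 \<Omega>"
  by (rule L2_bounded_linear[OF bounded_linear_snd])

lemma L2_Pair:
  assumes "f \<in> L2 \<Omega>" "h \<in> L2 \<Omega>"
  shows "(\<lambda>x. (f x, h x)) \<in> L2 \<Omega>"
proof -
  have "(\<lambda>x. (f x, 0) + (0, h x)) \<in> L2 \<Omega>"
    using L2_bounded_linear[OF bounded_linear_Pair[OF bounded_linear_ident bounded_linear_zero] assms(1)]
      L2_bounded_linear[OF bounded_linear_Pair[OF bounded_linear_zero bounded_linear_ident] assms(2)]
    by (rule L2_add)
  then show ?thesis by simp
qed

lemma L2_nth: "f \<in> L2 \<Omega> \<Longrightarrow> (\<lambda>x. f x $ i) \<in> L2 \<Omega>"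
  by (rule L2_bounded_linear[OF bounded_linear_vec_nth])

lemma L2_axis: "f \<in> L2 \<Omega> \<Longrightarrow> (\<lambda>x. axis i (f x)) \<in> L2 \<Omega>"
  by (rule L2_bounded_linear[where B = "axis i"])
    (auto intro!: linear_conv_bounded_linear[THEN iffD1] linearI simp: axis_def vec_eq_iff)

lemma L2_sum: "(\<And>i. i \<in> I \<Longrightarrow> f i \<in> L2 \<Omega>) \<Longrightarrow> (\<lambda>x. \<Sum>i\<in>I. f i x) \<in> L2 \<Omega>"
  by (induction I rule: infinite_finite_induct) (auto intro: L2_0 L2_add)

lemma L2_vec:
  fixes f :: "'a::euclidean_space \<Rightarrow> 'b::euclidean_space ^ 'n"
  assumes "\<And>i. (\<lambda>x. f x $ i) \<in> L2 \<Omega>"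
  shows "f \<in> L2 \<Omega>"
proof -
  have "(\<lambda>x. \<Sum>i\<in>UNIV. axis i (f x $ i)) \<in> L2 \<Omega>"
    using assms by (intro L2_sum L2_axis)
  moreover have "(\<Sum>i\<in>UNIV. axis i (f x $ i)) = f x" for x
    by (simp add: vec_eq_iff axis_def if_distrib cong: if_cong)
  ultimately show ?thesis by simp
qed

lemma L2_const:
  assumes "\<Omega> \<in> lmeasurable"
  shows "(\<lambda>x. c) \<in> L2 \<Omega>"
  using finite_measure.integrable_const[OF finite_measure_lebesgue_on[OF assms]]
  by (simp add: L2_def)

lemma L2_continuous:
  fixes \<phi> :: "'a::euclidean_space \<Rightarrow> real"
  assumes \<Omega>: "bounded \<Omega>" "\<Omega> \<in> sets lebesgue" and \<phi>: "continuous_on UNIV \<phi>"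
  shows "\<phi> \<in> L2 \<Omega>"
proof -
  have "compact (\<phi> ` closure \<Omega>)"
    using \<Omega> \<phi> by (intro compact_continuous_image)
      (auto intro: continuous_on_subset simp: compact_closure)
  then obtain C where "\<And>x. x \<in> closure \<Omega> \<Longrightarrow> \<bar>\<phi> x\<bar> \<le> C"
    using bounded_iff compact_imp_bounded by (metis imageI real_norm_def)
  then have "\<bar>\<phi> x\<bar> \<le> C" if "x \<in> \<Omega>" for x
    using that closure_subset by blast
  moreover have "\<phi> \<in> borel_measurable (lebesgue_on \<Omega>)"
    using \<phi> \<Omega> by (intro continuous_imp_measurable_on_sets_lebesgue) (auto intro: continuous_on_subset)
  ultimately have "(\<lambda>x. \<phi> x *\<^sub>R (1::real)) \<in> L2 \<Omega>"
    using \<Omega> by (intro L2_mult_bounded L2_const bounded_set_imp_lmeasurable)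
  then show ?thesis by simp
qed

lemma L2_imp_integrable:
  fixes f :: "'a::euclidean_space \<Rightarrow> real"
  assumes "\<Omega> \<in> lmeasurable" "f \<in> L2 \<Omega>"
  shows "integrable (lebesgue_on \<Omega>) f"
  using integrable_inner_L2[OF assms(2) L2_const[OF assms(1), of 1]] by simp

subsection \<open>Weak gradients\<close>

lemma test_fun_L2:
  assumes \<Omega>: "open \<Omega>" "bounded \<Omega>" and \<phi>: "\<phi> \<in> test_fun \<Omega>"
  shows "\<phi> \<in> L2 \<Omega>" and "(\<lambda>x. frechet_derivative \<phi> (at x) v) \<in> L2 \<Omega>"
proof -
  have "Ck 0 \<phi>" "Ck (Suc 0) \<phi>"
    using \<phi> by (auto simp: test_fun_def simp del: Ck.simps)
  then have "continuous_on UNIV \<phi>" "continuous_on UNIV (\<lambda>x. frechet_derivative \<phi> (at x) v)"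
    by auto
  then show "\<phi> \<in> L2 \<Omega>" "(\<lambda>x. frechet_derivative \<phi> (at x) v) \<in> L2 \<Omega>"
    using \<Omega> by (auto intro: L2_continuous simp: lebesgue_openin)
qed

lemma weak_grad_unique:
  assumes \<Omega>: "open \<Omega>" "bounded \<Omega>"
    and G: "has_weak_grad \<Omega> f G" and G': "has_weak_grad \<Omega> f G'"
  shows "AE x in lebesgue_on \<Omega>. G x = G' x"
proof -
  have L2: "(\<lambda>x. G x $ j) \<in> L2 \<Omega>" "(\<lambda>x. G' x $ j) \<in> L2 \<Omega>" for j
    using G G' by (auto simp: has_weak_grad_def L2_nth)
  \<comment> \<open>Finite measure turns square integrability into the integrability asked for by
    the fundamental lemma.\<close>
  have lm: "\<Omega> \<in> lmeasurable"
    using \<Omega> by (intro bounded_set_imp_lmeasurable) auto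
  have "AE x in lebesgue_on \<Omega>. G x $ j - G' x $ j = 0" for j
  proof (rule fundamental_lemma_calculus_of_variations[OF \<Omega>(1)])
    show "integrable (lebesgue_on \<Omega>) (\<lambda>x. G x $ j - G' x $ j)"
      by (intro L2_imp_integrable[OF lm] L2_diff L2)
    fix \<phi> assume \<phi>: "\<phi> \<in> test_fun \<Omega>"
    have "inner_L2 \<Omega> (\<lambda>x. G x $ j - G' x $ j) \<phi> = 0"
      using G G' \<phi> by (simp add: inner_L2_diff_left L2 test_fun_L2[OF \<Omega>] has_weak_grad_def)
    then show "(LINT x|lebesgue_on \<Omega>. (G x $ j - G' x $ j) * \<phi> x) = 0"
      by (simp add: inner_L2_def)
  qed
  then have "AE x in lebesgue_on \<Omega>. \<forall>j. G x $ j - G' x $ j = 0"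
    by (simp add: AE_all_countable)
  then show ?thesis
    by eventually_elim (simp add: vec_eq_iff)
qed

lemma has_weak_grad_wgrad: "f \<in> H1 \<Omega> \<Longrightarrow> has_weak_grad \<Omega> f (wgrad \<Omega> f)"
  unfolding wgrad_def H1_def using someI_ex[of "has_weak_grad \<Omega> f"] by simp

lemma H1v_L2: "u \<in> H1v \<Omega> \<Longrightarrow> u \<in> L2 \<Omega>"
  by (intro L2_vec) (auto simp: H1v_def H1_def)

lemma has_weak_grad_wGrad:
  "u \<in> H1v \<Omega> \<Longrightarrow> has_weak_grad \<Omega> (\<lambda>x. u x $ i) (\<lambda>x. wGrad \<Omega> u x $ i)"
  by (auto simp: wGrad_def H1v_def has_weak_grad_wgrad)

lemma wGrad_L2: "u \<in> H1v \<Omega> \<Longrightarrow> wGrad \<Omega> u \<in> L2 \<Omega>"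
  using has_weak_grad_wGrad by (intro L2_vec[of "wGrad \<Omega> u"]) (auto simp: has_weak_grad_def)

lemma H1vI:
  assumes "u \<in> L2 \<Omega>" and "\<And>i. has_weak_grad \<Omega> (\<lambda>x. u x $ i) (\<lambda>x. M x $ i)"
  shows "u \<in> H1v \<Omega>"
  using assms by (auto simp: H1v_def H1_def L2_nth)

lemma wGrad_unique:
  assumes \<Omega>: "open \<Omega>" "bounded \<Omega>"
    and u: "u \<in> L2 \<Omega>" and M: "\<And>i. has_weak_grad \<Omega> (\<lambda>x. u x $ i) (\<lambda>x. M x $ i)"
  shows "AE x in lebesgue_on \<Omega>. wGrad \<Omega> u x = M x"
proof -
  have "AE x in lebesgue_on \<Omega>. \<forall>i. wGrad \<Omega> u x $ i = M x $ i"
    using weak_grad_unique[OF \<Omega> has_weak_grad_wGrad[OF H1vI[OF u M]] M]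
    by (simp add: AE_all_countable)
  then show ?thesis
    by eventually_elim (simp add: vec_eq_iff)
qed

subsection \<open>The elliptic problem\<close>

lemma weight_measurable_bounded:
  fixes r :: "'a::euclidean_space \<Rightarrow> real"
  assumes "open \<Omega>" "continuous_on \<Omega> r" "0 < lo" "\<And>x. x \<in> \<Omega> \<Longrightarrow> lo \<le> r x \<and> r x \<le> up"
  shows "r \<in> borel_measurable (lebesgue_on \<Omega>)" and "\<And>x. x \<in> \<Omega> \<Longrightarrow> \<bar>r x\<bar> \<le> up"
  using assms by (auto intro!: continuous_imp_measurable_on_sets_lebesgue simp: lebesgue_openin)
    (fastforce dest: assms(4))

text \<open>The upper bound on \<open>r\<close> controls multiplication by the root, the positive
  lower bound controls division by it; both directions are needed to pass between a field and its
  weighted form.\<close>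

lemma weight_root:
  fixes r :: "'a::euclidean_space \<Rightarrow> real"
  assumes "open \<Omega>" "continuous_on \<Omega> r" "0 < lo" "\<And>x. x \<in> \<Omega> \<Longrightarrow> lo \<le> r x \<and> r x \<le> up"
  obtains s where "\<And>x. x \<in> \<Omega> \<Longrightarrow> 0 < s x \<and> s x * s x = r x"
    and "\<And>f::'a \<Rightarrow> 'b::euclidean_space. f \<in> L2 \<Omega> \<Longrightarrow> (\<lambda>x. s x *\<^sub>R f x) \<in> L2 \<Omega>"
    and "\<And>f::'a \<Rightarrow> 'b. f \<in> L2 \<Omega> \<Longrightarrow> (\<lambda>x. inverse (s x) *\<^sub>R f x) \<in> L2 \<Omega>"
proof
  note [measurable] = weight_measurable_bounded(1)[OF assms]
  have r: "0 < r x" if "x \<in> \<Omega>" for x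
    using assms(3,4) that by force
  show "0 < sqrt (r x) \<and> sqrt (r x) * sqrt (r x) = r x" if "x \<in> \<Omega>" for x
    using r[OF that] by simp
  have "\<bar>sqrt (r x)\<bar> \<le> sqrt up" if "x \<in> \<Omega>" for x
    using r[OF that] assms(4)[OF that] by simp
  then show "(\<lambda>x. sqrt (r x) *\<^sub>R f x) \<in> L2 \<Omega>" if "f \<in> L2 \<Omega>" for f :: "'a \<Rightarrow> 'b"
    using that by (intro L2_mult_bounded) auto
  have "\<bar>inverse (sqrt (r x))\<bar> \<le> inverse (sqrt lo)" if "x \<in> \<Omega>" for x
    using r[OF that] assms(3) assms(4)[OF that] by (simp add: le_imp_inverse_le)
  then show "(\<lambda>x. inverse (sqrt (r x)) *\<^sub>R f x) \<in> L2 \<Omega>" if "f \<in> L2 \<Omega>" for f :: "'a \<Rightarrow> 'b"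
    using that by (intro L2_mult_bounded) auto
qed

lemma inner_L2_cong:
  "(\<And>x. x \<in> \<Omega> \<Longrightarrow> f x \<bullet> h x = f' x \<bullet> h' x) \<Longrightarrow> inner_L2 \<Omega> f h = inner_L2 \<Omega> f' h'"
  unfolding inner_L2_def by (intro Bochner_Integration.integral_cong) auto

lemma inner_L2_Pair:
  assumes "f \<in> L2 \<Omega>" "f' \<in> L2 \<Omega>" "h \<in> L2 \<Omega>" "h' \<in> L2 \<Omega>"
  shows "inner_L2 \<Omega> (\<lambda>x. (f x, f' x)) (\<lambda>x. (h x, h' x)) = inner_L2 \<Omega> f h + inner_L2 \<Omega> f' h'"
  using assms by (simp add: inner_L2_def integrable_inner_L2)

lemma weak_solution_elliptic_exists:
  fixes \<Omega> :: "(real^'d) set"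
  assumes \<Omega>: "open \<Omega>" "bounded \<Omega>"
    and r0: "continuous_on \<Omega> r0" "0 < lo0" "\<And>x. x \<in> \<Omega> \<Longrightarrow> lo0 \<le> r0 x \<and> r0 x \<le> up0"
    and r1: "continuous_on \<Omega> r1" "0 < lo1" "\<And>x. x \<in> \<Omega> \<Longrightarrow> lo1 \<le> r1 x \<and> r1 x \<le> up1"
    and h: "h \<in> L2 \<Omega>"
  shows "\<exists>K. weak_solution_elliptic \<Omega> r0 r1 h K"
proof -
  obtain s0 where s0: "\<And>x. x \<in> \<Omega> \<Longrightarrow> 0 < s0 x \<and> s0 x * s0 x = r0 x"
    and s0_L2: "\<And>f::real^'d \<Rightarrow> real^'d. f \<in> L2 \<Omega> \<Longrightarrow> (\<lambda>x. s0 x *\<^sub>R f x) \<in> L2 \<Omega>"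
      "\<And>f::real^'d \<Rightarrow> real^'d. f \<in> L2 \<Omega> \<Longrightarrow> (\<lambda>x. inverse (s0 x) *\<^sub>R f x) \<in> L2 \<Omega>"
    using weight_root[OF \<Omega>(1) r0] by blast
  obtain s1 where s1: "\<And>x. x \<in> \<Omega> \<Longrightarrow> 0 < s1 x \<and> s1 x * s1 x = r1 x"
    and s1_L2: "\<And>f::real^'d \<Rightarrow> real^'d^'d. f \<in> L2 \<Omega> \<Longrightarrow> (\<lambda>x. s1 x *\<^sub>R f x) \<in> L2 \<Omega>"
      "\<And>f::real^'d \<Rightarrow> real^'d^'d. f \<in> L2 \<Omega> \<Longrightarrow> (\<lambda>x. inverse (s1 x) *\<^sub>R f x) \<in> L2 \<Omega>"
    using weight_root[OF \<Omega>(1) r1] by blast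
  have r_eq: "r0 x = s0 x * s0 x" "r1 x = s1 x * s1 x" if "x \<in> \<Omega>" for x
    using s0[OF that] s1[OF that] by auto
  \<comment> \<open>The plain product of two such pairs is the weighted product of H1 in which the
    matrix fields stand for the gradients.\<close>
  define emb :: "(real^'d \<Rightarrow> real^'d) \<Rightarrow> (real^'d \<Rightarrow> real^'d^'d) \<Rightarrow> real^'d \<Rightarrow> (real^'d) \<times> (real^'d^'d)"
    where "emb v M x = (s0 x *\<^sub>R v x, s1 x *\<^sub>R M x)" for v M x
  have emb_L2: "emb v M \<in> L2 \<Omega>" if "v \<in> L2 \<Omega>" "M \<in> L2 \<Omega>" for v M
    unfolding emb_def using that by (intro L2_Pair s0_L2 s1_L2)
  \<comment> \<open>The reciprocal weights cancel those of \<open>emb\<close>. Orthogonality to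
    \<open>Z \<phi> i j\<close> thus becomes the defining identity of the weak derivative of
    component \<open>i\<close> in direction \<open>j\<close>.\<close>
  define Z :: "(real^'d \<Rightarrow> real) \<Rightarrow> 'd \<Rightarrow> 'd \<Rightarrow> real^'d \<Rightarrow> (real^'d) \<times> (real^'d^'d)"
    where "Z \<phi> i j x = (inverse (s0 x) *\<^sub>R axis i (frechet_derivative \<phi> (at x) (axis j 1)),
      inverse (s1 x) *\<^sub>R axis i (axis j (\<phi> x)))" for \<phi> i j x
  define S where "S = {Z \<phi> i j |\<phi> i j. \<phi> \<in> test_fun \<Omega>}"
  have S_L2: "S \<subseteq> L2 \<Omega>"
    unfolding S_def Z_def using test_fun_L2[OF \<Omega>]
    by (auto intro!: L2_Pair s0_L2 s1_L2 L2_axis)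
  have emb_Z: "inner_L2 \<Omega> (emb v M) (Z \<phi> i j) =
      inner_L2 \<Omega> (\<lambda>x. v x $ i) (\<lambda>x. frechet_derivative \<phi> (at x) (axis j 1))
      + inner_L2 \<Omega> (\<lambda>x. M x $ i $ j) \<phi>"
    if "v \<in> L2 \<Omega>" "M \<in> L2 \<Omega>" "\<phi> \<in> test_fun \<Omega>" for v M \<phi> i j
  proof -
    have "inner_L2 \<Omega> (emb v M) (Z \<phi> i j) =
        inner_L2 \<Omega> (\<lambda>x. (v x $ i, M x $ i $ j)) (\<lambda>x. (frechet_derivative \<phi> (at x) (axis j 1), \<phi> x))"
    proof (rule inner_L2_cong)
      show "emb v M x \<bullet> Z \<phi> i j x =
          (v x $ i, M x $ i $ j) \<bullet> (frechet_derivative \<phi> (at x) (axis j 1), \<phi> x)" if "x \<in> \<Omega>" for x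
        using s0[OF that] s1[OF that] by (simp add: emb_def Z_def inner_axis field_simps)
    qed
    also have "\<dots> = inner_L2 \<Omega> (\<lambda>x. v x $ i) (\<lambda>x. frechet_derivative \<phi> (at x) (axis j 1))
      + inner_L2 \<Omega> (\<lambda>x. M x $ i $ j) \<phi>"
      using that by (intro inner_L2_Pair L2_nth test_fun_L2[OF \<Omega>])
    finally show ?thesis .
  qed
  have ortho_iff: "(\<forall>z\<in>S. inner_L2 \<Omega> (emb v M) z = 0) \<longleftrightarrow>
      (\<forall>i. has_weak_grad \<Omega> (\<lambda>x. v x $ i) (\<lambda>x. M x $ i))"
    if "v \<in> L2 \<Omega>" "M \<in> L2 \<Omega>" for v M
  proof -
    have "(\<forall>z\<in>S. inner_L2 \<Omega> (emb v M) z = 0) \<longleftrightarrow>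
        (\<forall>i. \<forall>\<phi>\<in>test_fun \<Omega>. \<forall>j. inner_L2 \<Omega> (emb v M) (Z \<phi> i j) = 0)"
      unfolding S_def by blast
    then show ?thesis
      using L2_nth[OF that(2)]
      by (simp add: emb_Z[OF that] has_weak_grad_def eq_neg_iff_add_eq_0)
  qed

  \<comment> \<open>Dividing by \<open>s0\<close> makes the pairing with
    \<open>emb \<phi> (wGrad \<Omega> \<phi>)\<close> equal to the unweighted pairing of
    \<open>h\<close> with \<open>\<phi>\<close>.\<close>
  let ?h = "\<lambda>x. (inverse (s0 x) *\<^sub>R h x, 0)"
  have h_L2: "?h \<in> L2 \<Omega>"
    by (rule L2_Pair[OF s0_L2(2)[OF h] L2_0])
  obtain p where "p \<in> {w \<in> L2 \<Omega>. \<forall>z\<in>S. inner_L2 \<Omega> w z = 0}"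
    and proj: "\<And>w. w \<in> {w \<in> L2 \<Omega>. \<forall>z\<in>S. inner_L2 \<Omega> w z = 0} \<Longrightarrow> inner_L2 \<Omega> p w = inner_L2 \<Omega> ?h w"
    by (rule L2_projection[OF S_L2 h_L2]) (rule that)
  then have p: "p \<in> L2 \<Omega>" "\<And>z. z \<in> S \<Longrightarrow> inner_L2 \<Omega> p z = 0"
    by auto
  define K where "K x = inverse (s0 x) *\<^sub>R fst (p x)" for x
  define M where "M x = inverse (s1 x) *\<^sub>R snd (p x)" for x
  have K: "K \<in> L2 \<Omega>" and M: "M \<in> L2 \<Omega>"
    unfolding K_def M_def using s0_L2(2)[OF L2_fst[OF p(1)]] s1_L2(2)[OF L2_snd[OF p(1)]] by auto
  \<comment> \<open>The roots are known to be nonzero only on \<Omega>, so the identity is pointwise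
    there; inner products see no more.\<close>
  have p_eq: "p x = emb K M x" if "x \<in> \<Omega>" for x
    using s0[OF that] s1[OF that] by (simp add: emb_def K_def M_def prod_eq_iff)
  then have p_inner: "inner_L2 \<Omega> p w = inner_L2 \<Omega> (emb K M) w" for w
    by (intro inner_L2_cong) simp
  have weak: "has_weak_grad \<Omega> (\<lambda>x. K x $ i) (\<lambda>x. M x $ i)" for i
    using ortho_iff[OF K M] p(2) p_inner by simp
  have "inner_L2 \<Omega> (\<lambda>x. r1 x *\<^sub>R wGrad \<Omega> K x) (wGrad \<Omega> \<phi>)
      + inner_L2 \<Omega> (\<lambda>x. r0 x *\<^sub>R K x) \<phi> = inner_L2 \<Omega> h \<phi>" if \<phi>: "\<phi> \<in> H1v \<Omega>" for \<phi>
  proof -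
    note [simp] = H1v_L2[OF \<phi>] wGrad_L2[OF \<phi>]
    note [measurable] = L2_D(1)[OF M] L2_D(1)[OF wGrad_L2[OF \<phi>]]
      L2_D(1)[OF wGrad_L2[OF H1vI[OF K weak]]] weight_measurable_bounded(1)[OF \<Omega>(1) r1]
    have "inner_L2 \<Omega> (\<lambda>x. r1 x *\<^sub>R wGrad \<Omega> K x) (wGrad \<Omega> \<phi>)
        = inner_L2 \<Omega> (\<lambda>x. r1 x *\<^sub>R M x) (wGrad \<Omega> \<phi>)"
      unfolding inner_L2_def
      by (rule integral_cong_AE) (use wGrad_unique[OF \<Omega> K weak] in auto)
    also have "\<dots> = inner_L2 \<Omega> (\<lambda>x. s1 x *\<^sub>R M x) (\<lambda>x. s1 x *\<^sub>R wGrad \<Omega> \<phi> x)"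
      by (rule inner_L2_cong) (simp add: r_eq)
    moreover have "inner_L2 \<Omega> (\<lambda>x. r0 x *\<^sub>R K x) \<phi> = inner_L2 \<Omega> (\<lambda>x. s0 x *\<^sub>R K x) (\<lambda>x. s0 x *\<^sub>R \<phi> x)"
      by (rule inner_L2_cong) (simp add: r_eq)
    ultimately have "inner_L2 \<Omega> (\<lambda>x. r1 x *\<^sub>R wGrad \<Omega> K x) (wGrad \<Omega> \<phi>)
        + inner_L2 \<Omega> (\<lambda>x. r0 x *\<^sub>R K x) \<phi> = inner_L2 \<Omega> (\<lambda>x. s0 x *\<^sub>R K x) (\<lambda>x. s0 x *\<^sub>R \<phi> x)
        + inner_L2 \<Omega> (\<lambda>x. s1 x *\<^sub>R M x) (\<lambda>x. s1 x *\<^sub>R wGrad \<Omega> \<phi> x)"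
      by simp
    also have "\<dots> = inner_L2 \<Omega> (emb K M) (emb \<phi> (wGrad \<Omega> \<phi>))"
      unfolding emb_def by (rule inner_L2_Pair[symmetric]) (auto intro: s0_L2 s1_L2 K M)
    also have "\<dots> = inner_L2 \<Omega> ?h (emb \<phi> (wGrad \<Omega> \<phi>))"
      unfolding p_inner[symmetric]
      using ortho_iff[of \<phi> "wGrad \<Omega> \<phi>"] has_weak_grad_wGrad[OF \<phi>]
      by (intro proj) (auto intro: emb_L2)
    also have "\<dots> = inner_L2 \<Omega> h \<phi>"
      by (intro inner_L2_cong) (use s0 in \<open>force simp: emb_def\<close>)
    finally show ?thesis .
  qed
  then have "weak_solution_elliptic \<Omega> r0 r1 h K"
    using H1vI[OF K weak] by (simp add: weak_solution_elliptic_def)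
  then show ?thesis by blast
qed

text \<open>The square is expanded into four pairings so that each one can be matched with an
  instance of the weak equation.\<close>

lemma inner_L2_weighted_diff_self:
  assumes "u \<in> L2 \<Omega>" "v \<in> L2 \<Omega>" "r \<in> borel_measurable (lebesgue_on \<Omega>)" "\<And>x. x \<in> \<Omega> \<Longrightarrow> \<bar>r x\<bar> \<le> C"
  shows "integrable (lebesgue_on \<Omega>) (\<lambda>x. r x * (norm (u x - v x))\<^sup>2)"
    and "(LINT x|lebesgue_on \<Omega>. r x * (norm (u x - v x))\<^sup>2) =
      inner_L2 \<Omega> (\<lambda>x. r x *\<^sub>R u x) u - inner_L2 \<Omega> (\<lambda>x. r x *\<^sub>R u x) v
      - inner_L2 \<Omega> (\<lambda>x. r x *\<^sub>R v x) u + inner_L2 \<Omega> (\<lambda>x. r x *\<^sub>R v x) v"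
proof -
  note L2 = L2_mult_bounded[OF _ assms(3,4)]
  have eq: "r x * (norm (u x - v x))\<^sup>2 = (r x *\<^sub>R u x - r x *\<^sub>R v x) \<bullet> (u x - v x)" for x
    by (simp add: power2_norm_eq_inner flip: scaleR_diff_right)
  show "integrable (lebesgue_on \<Omega>) (\<lambda>x. r x * (norm (u x - v x))\<^sup>2)"
    unfolding eq by (intro integrable_inner_L2 L2_diff L2 assms)
  show "(LINT x|lebesgue_on \<Omega>. r x * (norm (u x - v x))\<^sup>2) =
      inner_L2 \<Omega> (\<lambda>x. r x *\<^sub>R u x) u - inner_L2 \<Omega> (\<lambda>x. r x *\<^sub>R u x) v
      - inner_L2 \<Omega> (\<lambda>x. r x *\<^sub>R v x) u + inner_L2 \<Omega> (\<lambda>x. r x *\<^sub>R v x) v"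
    unfolding eq inner_L2_def[symmetric]
    using assms by (simp add: inner_L2_linear L2)
qed

text \<open>Testing both equations with \<open>K\<close> and \<open>K'\<close> themselves avoids the question
  whether the chosen weak gradients depend linearly on the field.\<close>

lemma weak_solution_elliptic_unique:
  fixes \<Omega> :: "(real^'d) set"
  assumes \<Omega>: "open \<Omega>"
    and r0: "continuous_on \<Omega> r0" "0 < lo0" "\<And>x. x \<in> \<Omega> \<Longrightarrow> lo0 \<le> r0 x \<and> r0 x \<le> up0"
    and r1: "continuous_on \<Omega> r1" "0 < lo1" "\<And>x. x \<in> \<Omega> \<Longrightarrow> lo1 \<le> r1 x \<and> r1 x \<le> up1"
    and K: "weak_solution_elliptic \<Omega> r0 r1 h K" and K': "weak_solution_elliptic \<Omega> r0 r1 h K'"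
  shows "ae_eq \<Omega> K K'"
proof -
  have H1: "K \<in> H1v \<Omega>" "K' \<in> H1v \<Omega>"
    using K K' by (auto simp: weak_solution_elliptic_def)
  note d0 = inner_L2_weighted_diff_self[OF H1[THEN H1v_L2] weight_measurable_bounded[OF \<Omega> r0]]
  note d1 = inner_L2_weighted_diff_self[OF H1[THEN wGrad_L2] weight_measurable_bounded[OF \<Omega> r1]]
  have pos0: "0 < r0 x" and pos1: "0 < r1 x" if "x \<in> \<Omega>" for x
    using r0(2,3) r1(2,3) that by force+
  have "(LINT x|lebesgue_on \<Omega>. r0 x * (norm (K x - K' x))\<^sup>2)
      + (LINT x|lebesgue_on \<Omega>. r1 x * (norm (wGrad \<Omega> K x - wGrad \<Omega> K' x))\<^sup>2) = 0"
  proof -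
    have eq: "inner_L2 \<Omega> (\<lambda>x. r1 x *\<^sub>R wGrad \<Omega> L x) (wGrad \<Omega> \<phi>)
        + inner_L2 \<Omega> (\<lambda>x. r0 x *\<^sub>R L x) \<phi> = inner_L2 \<Omega> h \<phi>"
      if "L \<in> {K, K'}" "\<phi> \<in> {K, K'}" for L \<phi>
      using that K K' H1 by (auto simp: weak_solution_elliptic_def)
    show ?thesis
      \<comment> \<open>In the alternating sum of the four equations the right-hand sides cancel in
        pairs.\<close>
      using eq[of K K] eq[of K K'] eq[of K' K] eq[of K' K'] by (simp add: d0(2) d1(2))
  qed
  moreover have "0 \<le> (LINT x|lebesgue_on \<Omega>. r0 x * (norm (K x - K' x))\<^sup>2)"
    using pos0 by (intro Bochner_Integration.integral_nonneg) (simp add: less_imp_le)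
  moreover have "0 \<le> (LINT x|lebesgue_on \<Omega>. r1 x * (norm (wGrad \<Omega> K x - wGrad \<Omega> K' x))\<^sup>2)"
    using pos1 by (intro Bochner_Integration.integral_nonneg) (simp add: less_imp_le)
  \<comment> \<open>Two nonnegative numbers with sum 0 both vanish; the zeroth-order term alone
    identifies the fields, since \<open>r0\<close> is positive.\<close>
  ultimately have "(LINT x|lebesgue_on \<Omega>. r0 x * (norm (K x - K' x))\<^sup>2) = 0"
    by linarith
  moreover have "AE x in lebesgue_on \<Omega>. 0 < r0 x"
    using pos0 by (intro AE_I2) simp
  moreover from this have "AE x in lebesgue_on \<Omega>. 0 \<le> r0 x * (norm (K x - K' x))\<^sup>2"
    by eventually_elim simp
  ultimately have "AE x in lebesgue_on \<Omega>. r0 x * (norm (K x - K' x))\<^sup>2 = 0"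
    using integral_nonneg_eq_0_iff_AE[OF d0(1)] by blast
  with \<open>AE x in lebesgue_on \<Omega>. 0 < r0 x\<close> show ?thesis
    unfolding ae_eq_def by eventually_elim simp
qed

section \<open>From Gateaux derivatives to the elliptic equation\<close>

lemma has_gateaux_derivative_unique:
  "has_gateaux_derivative J f \<delta> D \<Longrightarrow> has_gateaux_derivative J f \<delta> D' \<Longrightarrow> D = D'"
  unfolding has_gateaux_derivative_def by (rule tendsto_unique) simp_all

lemma is_sobolev_gradient_iff_weak_solution_elliptic:
  assumes "is_L2_gradient \<Omega> J f G"
  shows "is_sobolev_gradient \<Omega> r0 r1 J f K \<longleftrightarrow> weak_solution_elliptic \<Omega> r0 r1 G K"
proof -
  have "has_gateaux_derivative J f \<delta> D \<longleftrightarrow> D = inner_L2 \<Omega> G \<delta>" if "\<delta> \<in> H1v \<Omega>" for \<delta> D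
    using assms H1v_L2[OF that] has_gateaux_derivative_unique[of J f \<delta>]
    by (auto simp: is_L2_gradient_def)
  then show ?thesis
    by (auto simp: is_sobolev_gradient_def weak_solution_elliptic_def inner_H1v_def add.commute)
qed

theorem theorem4p7:
  fixes \<Omega> :: "(real^'d) set"
    and T \<rho> C\<^sub>s \<kappa> T\<^sub>0 lam \<mu> \<alpha>\<^sub>T \<gamma> \<beta> :: real
    and k g :: "real \<Rightarrow> real"
    and u :: "(real^'d \<Rightarrow> real^'d) \<Rightarrow> real \<Rightarrow> real^'d \<Rightarrow> real^'d"
    and \<theta> :: "(real^'d \<Rightarrow> real^'d) \<Rightarrow> real \<Rightarrow> real^'d \<Rightarrow> real"
    and u_adj :: "real \<Rightarrow> real^'d \<Rightarrow> real^'d"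
    and \<theta>_adj :: "real \<Rightarrow> real^'d \<Rightarrow> real"
    and f \<Xi> G :: "real^'d \<Rightarrow> real^'d"
    and r\<^sub>0 r\<^sub>1 :: "real^'d \<Rightarrow> real"
    and r\<^sub>0_lo r\<^sub>0_up r\<^sub>1_lo r\<^sub>1_up :: real
  assumes "open \<Omega>" and "bounded \<Omega>" and "lipschitz_boundary \<Omega>"
    and "T > 0" and "\<rho> > 0" and "C\<^sub>s > 0" and "\<kappa> > 0" and "T\<^sub>0 > 0" and "lam > 0" and "\<mu> > 0" and "\<alpha>\<^sub>T > 0"
    and gamma: "\<gamma> = \<alpha>\<^sub>T * (3 * lam + 2 * \<mu>)"
    and "admissible_kernel T k"
    and "admissible_g T g"
    and solution: "\<And>h. h \<in> L2 \<Omega> \<Longrightarrow> weak_solution_P1 \<Omega> T \<rho> C\<^sub>s \<kappa> T\<^sub>0 lam \<mu> \<gamma> k g h (u h) (\<theta> h)"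
    and "\<Xi> \<in> L2 \<Omega>" and "\<beta> \<ge> 0"
    and "continuous_on \<Omega> r\<^sub>0" and "0 < r\<^sub>0_lo" and "\<And>x. x \<in> \<Omega> \<Longrightarrow> r\<^sub>0_lo \<le> r\<^sub>0 x \<and> r\<^sub>0 x \<le> r\<^sub>0_up"
    and "continuous_on \<Omega> r\<^sub>1" and "0 < r\<^sub>1_lo" and "\<And>x. x \<in> \<Omega> \<Longrightarrow> r\<^sub>1_lo \<le> r\<^sub>1 x \<and> r\<^sub>1 x \<le> r\<^sub>1_up"
    and "f \<in> L2 \<Omega>"
    and adjoint: "weak_solution_adjoint \<Omega> T \<rho> C\<^sub>s \<kappa> T\<^sub>0 lam \<mu> \<gamma> k (\<lambda>x. u f T x - \<Xi> x) u_adj \<theta>_adj"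
    and L2_gradient: "is_L2_gradient \<Omega> (cost \<Omega> T \<beta> \<Xi> u) f G"
    and L2_gradient_formula:
      "ae_eq \<Omega> G (\<lambda>x. - (1 / \<rho>) *\<^sub>R L2_int \<Omega> {0..T} (\<lambda>t y. g t *\<^sub>R u_adj t y) x + \<beta> *\<^sub>R f x)"
  shows "(\<exists>S. is_sobolev_gradient \<Omega> r\<^sub>0 r\<^sub>1 (cost \<Omega> T \<beta> \<Xi> u) f S) \<and>
    (\<forall>S S'. is_sobolev_gradient \<Omega> r\<^sub>0 r\<^sub>1 (cost \<Omega> T \<beta> \<Xi> u) f S \<longrightarrow>
       is_sobolev_gradient \<Omega> r\<^sub>0 r\<^sub>1 (cost \<Omega> T \<beta> \<Xi> u) f S' \<longrightarrow> ae_eq \<Omega> S S') \<and>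
    (\<forall>K. is_sobolev_gradient \<Omega> r\<^sub>0 r\<^sub>1 (cost \<Omega> T \<beta> \<Xi> u) f K \<longleftrightarrow> weak_solution_elliptic \<Omega> r\<^sub>0 r\<^sub>1 G K)"
proof -
  note grad_iff = is_sobolev_gradient_iff_weak_solution_elliptic[OF L2_gradient, of r\<^sub>0 r\<^sub>1]
  have "G \<in> L2 \<Omega>"
    using L2_gradient by (simp add: is_L2_gradient_def)
  then show ?thesis
    \<comment> \<open>This makes the last conjunct trivial and turns the first two into existence of
      weak solutions and their uniqueness up to null sets.\<close>
    unfolding grad_iff
    using weak_solution_elliptic_exists[OF assms(1,2,18-23)]
      weak_solution_elliptic_unique[OF assms(1,18-23)]
    by blast
qed

end
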